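(* For every positive integer $n$ and for every $k \in \{2,3,4\}$, there exist connected graphs $H_1,\dots,H_k$ such that (i) if $k=4$, then $H_1, H_2, H_3, H_4$ are trees with $\mathrm{td}(H_i)=3$ for each $i\in\{1,2,3,4\}$; (ii) if $k=3$, then $H_1, H_2$ are trees with $\mathrm{td}(H_1)=\mathrm{td}(H_2)=3$, and $\mathrm{pw}(H_3)=2$, $\mathrm{td}(H_3)=4$; (iii) if $k=2$, then $\mathrm{pw}(H_1)=\mathrm{pw}(H_2)=2$, and $\mathrm{td}(H_1)=3$, $\mathrm{td}(H_2)=4$; and there exists a graph $G_n$ with $\mathrm{tw}(G_n)\geq n$ such that each of $H_1,\dots,H_k$ is an isometric subgraph of $G_n$ and $H_1,\dots,H_k$ edge cover $G_n$.
   Context: Graphs are finite, simple and undirected; isomorphism issues are ignored (graphs are identified up to isomorphism where convenient). The distance $\mathrm{dist}_G(u,v)$ of two vertices $u,v$ in a connected graph $G$ is the minimum number of edges of a path connecting $u$ and $v$. A connected subgraph $H$ of a graph $G$ is isometric if $\mathrm{dist}_H(u,v)=\mathrm{dist}_G(u,v)$ for all vertices $u,v$ of $H$. A set $\mathcal{H}$ of subgraphs of $G$ edge covers $G$ if $E(G)=\bigcup_{H\in\mathcal{H}}E(H)$. A tree decomposition of $G$ is a pair $(T,(W_x \mid x\in V(T)))$ where $T$ is a tree and $W_x\subseteq V(G)$ for every $x \in V(T)$, such that for every $u\in V(G)$ the subgraph $T[\{x\in V(T) \mid u\in W_x\}]$ is connected, and for every edge $uv\in E(G)$ there is $x\in V(T)$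 with $u,v\in W_x$. Its width is $\max_{x\in V(T)}|W_x|-1$. The treewidth $\mathrm{tw}(G)$ is the minimum width of a tree decomposition of $G$; the pathwidth $\mathrm{pw}(G)$ is the minimum width of a tree decomposition of $G$ in which $T$ is a path. The treedepth $\mathrm{td}(G)$ is defined recursively: $\mathrm{td}(G)=0$ if $G$ has no vertices; if $G$ is not connected, $\mathrm{td}(G)$ is the maximum of $\mathrm{td}(C)$ over the components $C$ of $G$; if $G$ is connected (and nonempty), $\mathrm{td}(G)=\min_{v\in V(G)}\mathrm{td}(G-v)+1$. *)

theory Defs
  imports "Graph_Theory.Graph_Theory"
begin

text \<open>
  A finite simple undirected graph is a member of the locale \<^locale>\<open>graph\<close> (a finite,
  loop-free, symmetric digraph without parallel arcs): an edge uv is the pair of arcs from u to v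
  and from v to u.  In that locale \<^const>\<open>pre_digraph.sccs\<close> is the set of connected
  components.  The graph without vertices does not count as connected.
\<close>

text \<open>
  In a symmetric digraph an edge traversed back and forth is a \<^const>\<open>pre_digraph.cycle\<close>
  of length 2.  Hence the library's \<^const>\<open>tree\<close> fails for every graph with an edge, and
  only cycles of length at least 3 may be excluded here.
\<close>

definition is_tree :: "('a, 'b) pre_digraph \<Rightarrow> bool" where
  "is_tree G \<longleftrightarrow> graph G \<and> connected G \<and> \<not> (\<exists>p. pre_digraph.cycle G p \<and> 3 \<le> length p)"

definition is_path :: "('a, 'b) pre_digraph \<Rightarrow> bool" where
  "is_path G \<longleftrightarrow> graph G \<and>
     (\<exists>p. p \<noteq> [] \<and> distinct p \<and> verts G = set p \<and>
          arcs_ends G = set (vwalk_arcs p) \<union> (set (vwalk_arcs p))\<inverse>)"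

definition graph_dist :: "('a, 'b) pre_digraph \<Rightarrow> 'a \<Rightarrow> 'a \<Rightarrow> nat" where
  "graph_dist G u v = (LEAST n. \<exists>p. pre_digraph.apath G u p v \<and> length p = n)"

definition isometric_subgraph :: "('a, 'b) pre_digraph \<Rightarrow> ('a, 'b) pre_digraph \<Rightarrow> bool" where
  "isometric_subgraph H G \<longleftrightarrow> graph H \<and> subgraph H G \<and> connected H \<and>
     (\<forall>u\<in>verts H. \<forall>v\<in>verts H. graph_dist H u v = graph_dist G u v)"

definition edge_covers :: "('a, 'b) pre_digraph set \<Rightarrow> ('a, 'b) pre_digraph \<Rightarrow> bool" where
  "edge_covers \<H> G \<longleftrightarrow> (\<forall>H\<in>\<H>. graph H \<and> subgraph H G) \<and> arcs G = (\<Union>H\<in>\<H>. arcs H)"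

text \<open>
  Every finite tree is isomorphic to one whose vertices are natural numbers, so taking the
  decomposition tree over \<^typ>\<open>nat\<close> is no restriction.
\<close>

definition tree_decomposition ::
  "('a, 'b) pre_digraph \<Rightarrow> (nat, nat \<times> nat) pre_digraph \<Rightarrow> (nat \<Rightarrow> 'a set) \<Rightarrow> bool" where
  "tree_decomposition G T W \<longleftrightarrow> is_tree T \<and>
     (\<forall>x\<in>verts T. W x \<subseteq> verts G) \<and>
     (\<forall>u\<in>verts G. connected (T \<restriction> {x\<in>verts T. u \<in> W x})) \<and>
     (\<forall>(u, v)\<in>arcs_ends G. \<exists>x\<in>verts T. u \<in> W x \<and> v \<in> W x)"

text \<open>Widths are integers because the graph without vertices has width -1.\<close>

definition decomposition_width ::
  "(nat, nat \<times> nat) pre_digraph \<Rightarrow> (nat \<Rightarrow> 'a set) \<Rightarrow> int" where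
  "decomposition_width T W = Max ((\<lambda>x. int (card (W x))) ` verts T) - 1"

definition treewidth :: "('a, 'b) pre_digraph \<Rightarrow> int" where
  "treewidth G = (LEAST w. \<exists>T W. tree_decomposition G T W \<and> decomposition_width T W = w)"

definition pathwidth :: "('a, 'b) pre_digraph \<Rightarrow> int" where
  "pathwidth G =
     (LEAST w. \<exists>T W. tree_decomposition G T W \<and> is_path T \<and> decomposition_width T W = w)"

lemma card_verts_component_less:
  assumes "finite (verts G)" "\<not> connected G" "H \<in> pre_digraph.sccs G"
  shows "card (verts H) < card (verts G)"
proof -
  have ind: "induced_subgraph H G" and sc: "strongly_connected H"
    using assms(3) unfolding pre_digraph.sccs_def by blast+
  have sub: "verts H \<subseteq> verts G"
    using ind unfolding induced_subgraph_def subgraph_def by blast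
  have "verts H \<noteq> verts G"
  proof
    assume eq: "verts H = verts G"
    have "arcs_ends H \<subseteq> arcs_ends (with_proj (mk_symmetric G))"
      using ind by (auto simp: induced_subgraph_def subgraph_def compatible_def
          mk_symmetric_def arcs_ends_conv)
    then have "strongly_connected (with_proj (mk_symmetric G))"
      using sc eq unfolding strongly_connected_def reachable_def
      by (metis (no_types, lifting) mk_symmetric_def order_refl pair_pre_digraph.select_convs(1)
          rtrancl_on_mono with_proj_simps(1))
    with assms(2) show False unfolding connected_def by simp
  qed
  with sub assms(1) show ?thesis by (meson psubsetI psubset_card_mono)
qed

lemma card_verts_del_vert_less:
  assumes "finite (verts G)" "v \<in> verts G"
  shows "card (verts (pre_digraph.del_vert G v)) < card (verts G)"
  using assms unfolding pre_digraph.del_vert_def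
  by (simp only: pre_digraph.select_convs card_Diff1_less)

text \<open>The case of infinitely many vertices is a dummy that makes the recursion terminate.\<close>

function treedepth :: "('a, 'b) pre_digraph \<Rightarrow> nat" where
  "treedepth G =
     (if infinite (verts G) \<or> verts G = {} then 0
      else if \<not> connected G then Max (treedepth ` pre_digraph.sccs G)
      else Min ((\<lambda>v. treedepth (pre_digraph.del_vert G v)) ` verts G) + 1)"
  by pat_completeness auto

termination
  by (relation "measure (\<lambda>G. card (verts G))")
     (simp_all only: wf_measure in_measure de_Morgan_disj not_not
       card_verts_component_less card_verts_del_vert_less simp_thms)

declare treedepth.simps [simp del]

end

theory Submission
  imports Defs "HOL-Library.Sublist" "HOL-Library.Countable"
begin

text \<open>
  The graph is built from a base graph of maximum degree 3 by subdivision and the addition of a few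
  vertices of high degree.  The base graph has \<open>m = n + 1\<close> paths called row tracks and \<open>m\<close> paths
  called column tracks; for all \<open>i, j\<close> a link vertex is adjacent to one vertex of row \<open>i\<close> and to
  one vertex of column \<open>j\<close>, and different links use different vertices of a track.  Contracting
  row \<open>i\<close>, column \<open>i\<close> and the links of row \<open>i\<close> for every \<open>i\<close> yields the complete graph on
  \<open>m\<close> vertices, so the treewidth is at least \<open>n\<close>, and subdividing edges or adding vertices does
  not change this.

  The base vertices are coloured with \<open>k\<close> colours, every edge of the base graph is subdivided once,
  and for every colour \<open>c\<close> an apex is added that is adjacent to all base vertices of colour \<open>c\<close>.
  The graph \<open>H c\<close> is induced by the apex of \<open>c\<close>, the base vertices of colour \<open>c\<close> and the
  subdivision vertices next to them.  Every edge of the subdivided graph has exactly one base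
  vertex as an end, so these graphs cover all edges.  They are isometric because they are retracts:
  if every base vertex \<open>x\<close> outside the class has at most one neighbour of colour \<open>c\<close> in the base
  graph, then \<open>x\<close> is sent to that neighbour, and all remaining vertices go to the apex
  (\<open>isometric_H\<close>).

  If a colour class is independent in the base graph, then \<open>H c\<close> (without the additional edges
  that the case \<open>k = 2\<close> below requires) is a tree in which all vertices
  have distance at most 2 from the apex; its treedepth is 3, as it contains a path with four vertices.
  For \<open>k = 4\<close> the positions on the tracks are coloured cyclically with 1, 2, 3, where the columns
  are shifted by one against the rows, and the links have colour 4.  Then the neighbours of every
  vertex have distinct colours different from its own, and all four graphs are trees.
  For \<open>k = 3\<close> the links and all positions divisible by 3, among them the ends of the links, have
  colour 3.  This class induces paths with three vertices, centred at the links, and isolated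
  vertices, so \<open>H 3\<close> without the apex is a disjoint union of caterpillars of treedepth at most 3.
  As \<open>H 3\<close> also contains a cycle and a path with eight vertices, it has pathwidth 2 and treedepth 4
  (\<open>treedepth_pathwidth_link_class\<close>).
  For \<open>k = 2\<close> the odd positions have colour 1 and everything else has colour 2, so the first
  class is independent and the second one is as before; the bounds on the treedepth are the same,
  and a cycle through the apex again gives the lower bound on the pathwidth.  Here vertices
  of one class may have two neighbours in the other, so the apex of a colour is also joined to the
  subdivision vertices of its graph.  Then the apex is adjacent to all other vertices of \<open>H c\<close>, and
  the map that sends everything outside \<open>H c\<close> to the apex is a retraction.

  The parameters are computed with four criteria: the treedepth is at most \<open>d\<close> if the
  vertices can be labelled injectively by nonempty lists of length at most \<open>d\<close> such that labels of
  adjacent vertices are prefix-comparable (\<open>treedepth_le\<close>), it exceeds \<open>d\<close> if there is a path with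
  \<open>2 ^ d\<close> vertices (\<open>treedepth_gt\<close>), a complete minor on \<open>m\<close> vertices forces a bag with \<open>m\<close>
  elements in every tree decomposition (\<open>clique_minor_width\<close>), and an interval representation gives
  a path decomposition (\<open>interval_tree_decomposition\<close>).
\<close>

section \<open>Connectedness, induced subgraphs and treedepth\<close>

lemma connected_graph_iff:
  assumes "graph G"
  shows "connected G \<longleftrightarrow>
    verts G \<noteq> {} \<and> (\<forall>u\<in>verts G. \<forall>v\<in>verts G. (u, v) \<in> (arcs_ends G)\<^sup>*)"
proof -
  interpret graph G by fact
  have "symmetric G" by (rule sym_arcs)
  then have "connected G \<longleftrightarrow> verts G \<noteq> {} \<and> (\<forall>u\<in>verts G. \<forall>v\<in>verts G. u \<rightarrow>\<^sup>*\<^bsub>G\<^esub> v)"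
    unfolding connected_def strongly_connected_def
    using reachable_mk_symmetric_eq by simp
  then show ?thesis
    by (auto simp: reachable_conv')
qed

lemma arcs_ends_graph:
  assumes "graph G"
  shows "(u, v) \<in> arcs_ends G \<Longrightarrow> (v, u) \<in> arcs_ends G"
    and "(u, v) \<in> arcs_ends G \<Longrightarrow> u \<in> verts G \<and> v \<in> verts G"
    and "(u, u) \<notin> arcs_ends G"
proof -
  interpret graph G by fact
  show "(u, v) \<in> arcs_ends G \<Longrightarrow> (v, u) \<in> arcs_ends G"
    by (rule graph_symmetric)
  show "(u, v) \<in> arcs_ends G \<Longrightarrow> u \<in> verts G \<and> v \<in> verts G"
    using adj_in_verts by blast
  show "(u, u) \<notin> arcs_ends G"
    using adj_not_same by blast
qed

lemma graph_induced_subgraph: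
  assumes "graph G" "induced_subgraph H G"
  shows "graph H"
proof -
  interpret graph G by fact
  interpret H: digraph H using digraphI_induced[OF assms(2)] .
  show ?thesis
    using induced_graph_imp_symmetric[OF sym_arcs assms(2)] by (rule H.graphI)
qed

lemma arcs_ends_induced_subgraph:
  assumes "induced_subgraph H G"
  shows "arcs_ends H = arcs_ends G \<inter> verts H \<times> verts H"
proof -
  have c: "tail G = tail H" "head G = head H"
    using assms by (auto simp: induced_subgraph_def subgraph_def compatible_def)
  have a: "arcs H = {e \<in> arcs G. tail G e \<in> verts H \<and> head G e \<in> verts H}"
    using assms by (auto simp: induced_subgraph_def)
  show ?thesis
    unfolding arcs_ends_conv a c[symmetric] by auto
qed

lemma induced_subgraph_del_vert:
  assumes "graph G"
  shows "induced_subgraph (pre_digraph.del_vert G v) G"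
proof -
  interpret graph G by fact
  show ?thesis
    by (rule induced_subgraphI[OF subgraph_del_vert]) (auto simp: del_vert_simps)
qed

lemma sccs_induced:
  "H \<in> pre_digraph.sccs G \<Longrightarrow> induced_subgraph H G"
  by (simp add: pre_digraph.sccs_def)

lemma finite_sccs:
  assumes "graph G"
  shows "finite (pre_digraph.sccs G)"
proof -
  interpret graph G by fact
  show ?thesis
    unfolding sccs_conv_sccs_verts by (simp add: finite_sccs_verts)
qed

lemma sccs_nonempty:
  assumes "graph G" "v \<in> verts G"
  obtains H where "H \<in> pre_digraph.sccs G" "v \<in> verts H"
proof -
  interpret graph G by fact
  show ?thesis
    using scc_for_vert_ex[OF assms(2)] that by blast
qed

lemma sccs_closed:
  assumes "graph G" "H \<in> pre_digraph.sccs G" "u \<in> verts H" "(u, v) \<in> arcs_ends G"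
  shows "v \<in> verts H"
proof -
  interpret graph G by fact
  have "verts H \<in> sccs_verts"
    using assms(2) by (simp add: sccs_verts_conv)
  then show ?thesis
    using assms(3,4) graph_symmetric[OF assms(4)]
    unfolding sccs_verts_def by (blast intro: reachable_adjI)
qed

lemma treedepth_connected:
  assumes "graph G" "connected G"
  shows "treedepth G = Min ((\<lambda>v. treedepth (pre_digraph.del_vert G v)) ` verts G) + 1"
proof -
  interpret graph G by fact
  have "verts G \<noteq> {}"
    using assms by (simp add: connected_graph_iff)
  then show ?thesis
    using assms(2) by (subst treedepth.simps) simp
qed

lemma treedepth_not_connected:
  assumes "graph G" "\<not> connected G" "verts G \<noteq> {}"
  shows "treedepth G = Max (treedepth ` pre_digraph.sccs G)"
proof -
  interpret graph G by fact
  show ?thesis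
    using assms by (subst treedepth.simps) simp
qed

text \<open>
  For an elimination forest of height \<open>d\<close> the label of a vertex can be the list of its ancestors
  from the root down to itself; the forest itself never has to be represented.
\<close>

lemma treedepth_le:
  fixes l :: "'a \<Rightarrow> 'c list"
  assumes "graph G" "inj_on l (verts G)"
    and "\<And>u v. (u, v) \<in> arcs_ends G \<Longrightarrow> prefix (l u) (l v) \<or> prefix (l v) (l u)"
    and "\<And>v. v \<in> verts G \<Longrightarrow> l v \<noteq> [] \<and> length (l v) \<le> d"
  shows "treedepth G \<le> d"
  using assms
proof (induction "card (verts G)" arbitrary: G l d rule: less_induct)
  case (less G l d)
  interpret graph G by fact
  consider "verts G = {}" | "verts G \<noteq> {}" "\<not> connected G" | "connected G"
    by blast
  then show ?case
  proof cases
    case 1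
    then show ?thesis by (subst treedepth.simps) simp
  next
    case 2
    have "treedepth H \<le> d" if H: "H \<in> sccs" for H
    proof (rule less.hyps)
      have ind: "induced_subgraph H G"
        using H by (rule sccs_induced)
      then have sub: "verts H \<subseteq> verts G" by blast
      show "card (verts H) < card (verts G)"
        using 2 H by (simp add: card_verts_component_less)
      show "graph H"
        using graph_induced_subgraph[OF less.prems(1) ind] .
      show "inj_on l (verts H)"
        using sub less.prems(2) by (rule inj_on_subset[rotated])
      show "prefix (l u) (l v) \<or> prefix (l v) (l u)" if "(u, v) \<in> arcs_ends H" for u v
        using that less.prems(3) by (simp add: arcs_ends_induced_subgraph[OF ind])
      show "l v \<noteq> [] \<and> length (l v) \<le> d" if "v \<in> verts H" for v
        using that sub less.prems(4) by blast
    qed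
    moreover have "sccs \<noteq> {}"
      using 2 sccs_nonempty[OF less.prems(1)] by blast
    ultimately show ?thesis
      using treedepth_not_connected[OF less.prems(1) 2(2,1)] finite_sccs[OF less.prems(1)]
      by simp
  next
    case 3
    \<comment> \<open>Comparable nonempty lists share their first entry, so all labels of a connected graph do.\<close>
    have step: "hd (l u) = hd (l v)" if "(u, v) \<in> arcs_ends G" for u v
    proof -
      have "l u \<noteq> []" "l v \<noteq> []"
        using that less.prems(4) arcs_ends_graph(2)[OF less.prems(1)] by blast+
      then show ?thesis
        using less.prems(3)[OF that] by (auto simp: prefix_def neq_Nil_conv)
    qed
    have "hd (l u) = hd (l v)" if "(u, v) \<in> (arcs_ends G)\<^sup>*" for u v
      using that by induction (auto dest: step)
    then obtain h where h: "\<And>v. v \<in> verts G \<Longrightarrow> hd (l v) = h"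
      using 3 by (metis connected_graph_iff[OF less.prems(1)])
    have "verts G \<noteq> {}"
      using 3 by (simp add: connected_graph_iff[OF less.prems(1)])
    then obtain r where r: "r \<in> verts G" "(\<exists>v\<in>verts G. l v = [h]) \<Longrightarrow> l r = [h]"
      by blast
    \<comment> \<open>Delete the vertex labelled \<open>[h]\<close> if there is one; then all other labels can lose their head.\<close>
    let ?H = "pre_digraph.del_vert G r"
    have ind: "induced_subgraph ?H G"
      using less.prems(1) by (rule induced_subgraph_del_vert)
    have V: "verts ?H = verts G - {r}"
      by (simp add: verts_del_vert)
    have l: "l v = h # tl (l v)" if "v \<in> verts G" for v
      using that h less.prems(4) by (metis list.collapse)
    have "treedepth ?H \<le> d - 1"
    proof (rule less.hyps)
      show "card (verts ?H) < card (verts G)"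
        using r(1) by (simp add: card_verts_del_vert_less)
      show "graph ?H"
        using graph_induced_subgraph[OF less.prems(1) ind] .
      show "inj_on (\<lambda>v. tl (l v)) (verts ?H)"
        using less.prems(2) l unfolding V inj_on_def by (metis DiffD1)
      show "prefix (tl (l u)) (tl (l v)) \<or> prefix (tl (l v)) (tl (l u))"
        if "(u, v) \<in> arcs_ends ?H" for u v
      proof -
        have "(u, v) \<in> arcs_ends G" "u \<in> verts G" "v \<in> verts G"
          using that V by (auto simp: arcs_ends_induced_subgraph[OF ind])
        then show ?thesis
          using less.prems(3) l by (metis Cons_prefix_Cons)
      qed
      show "tl (l v) \<noteq> [] \<and> length (tl (l v)) \<le> d - 1" if "v \<in> verts ?H" for v
      proof -
        have v: "v \<in> verts G" "v \<noteq> r"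
          using that V by auto
        have "l v \<noteq> [h]"
          using r v less.prems(2) by (metis inj_onD)
        then have "tl (l v) \<noteq> []"
          using l[OF v(1)] by metis
        then show ?thesis
          using less.prems(4)[OF v(1)] by (simp add: diff_le_mono)
      qed
    qed
    moreover have "treedepth G \<le> treedepth ?H + 1"
      using r(1) by (simp add: treedepth_connected[OF less.prems(1) 3])
    moreover have "d \<ge> 1"
      using less.prems(4)[OF r(1)] by (cases "l r") auto
    ultimately show ?thesis by linarith
  qed
qed

text \<open>
  Deleting a vertex from a path leaves a subpath with at least half of the remaining vertices.
\<close>

lemma treedepth_gt:
  assumes "graph G" "distinct p" "set p \<subseteq> verts G"
    and "successively (\<lambda>u v. (u, v) \<in> arcs_ends G) p" "2 ^ d \<le> length p"
  shows "d < treedepth G"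
  using assms
proof (induction "card (verts G)" arbitrary: G p d rule: less_induct)
  case (less G p d)
  interpret graph G by fact
  have p: "p \<noteq> []"
    using less.prems(5) by (auto simp: not_le)
  then have hd: "hd p \<in> verts G"
    using less.prems(3) by auto
  show ?case
  proof (cases "connected G")
    case False
    obtain H where H: "H \<in> sccs" "hd p \<in> verts H"
      using sccs_nonempty[OF less.prems(1) hd] .
    have ind: "induced_subgraph H G"
      using H(1) by (rule sccs_induced)
    have "set q \<subseteq> verts H"
      if "successively (\<lambda>u v. (u, v) \<in> arcs_ends G) q" "q \<noteq> []" "hd q \<in> verts H" for q
      using that
    proof (induction q rule: induct_list012)
      case (3 x y zs)
      then show ?case
        using sccs_closed[OF less.prems(1) H(1)] by auto
    qed auto
    then have sub: "set p \<subseteq> verts H"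
      using less.prems(4) p H(2) by blast
    have "d < treedepth H"
    proof (rule less.hyps)
      show "card (verts H) < card (verts G)"
        using False H by (simp add: card_verts_component_less)
      show "graph H"
        using graph_induced_subgraph[OF less.prems(1) ind] .
      show "successively (\<lambda>u v. (u, v) \<in> arcs_ends H) p"
        using less.prems(4)
        by (rule successively_mono)
          (use sub in \<open>auto simp: arcs_ends_induced_subgraph[OF ind]\<close>)
    qed (use less.prems sub in auto)
    also have "treedepth H \<le> treedepth G"
    proof -
      have "treedepth G = Max (treedepth ` sccs)"
        using less.prems(1) False by (rule treedepth_not_connected) (use hd in auto)
      then show ?thesis
        using H(1) finite_sccs[OF less.prems(1)] by simp
    qed
    finally show ?thesis .
  next
    case True
    have "d \<le> treedepth (del_vert v)" if v: "v \<in> verts G" for v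
    proof (cases d)
      case (Suc e)
      have ind: "induced_subgraph (del_vert v) G"
        using less.prems(1) by (rule induced_subgraph_del_vert)
      have "\<exists>q. v \<notin> set q \<and> distinct q \<and> set q \<subseteq> verts G \<and>
          successively (\<lambda>u v. (u, v) \<in> arcs_ends G) q \<and> 2 ^ e \<le> length q"
      proof (cases "v \<in> set p")
        case False
        have "2 ^ e \<le> length p"
          using less.prems(5) by (simp add: Suc)
        then show ?thesis
          using False less.prems by blast
      next
        case True
        then obtain a b where ab: "p = a @ v # b"
          by (meson split_list)
        have "2 ^ e \<le> length a \<or> 2 ^ e \<le> length b"
          using less.prems(5) unfolding ab Suc by simp linarith
        then show ?thesis
          using less.prems(2-4) unfolding ab
          by (auto simp: successively_append_iff successively_Cons)
      qed
      then obtain q where q: "v \<notin> set q" "distinct q" "set q \<subseteq> verts G"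
          "successively (\<lambda>u v. (u, v) \<in> arcs_ends G) q" "2 ^ e \<le> length q"
        by blast
      have "e < treedepth (del_vert v)"
      proof (rule less.hyps)
        show "card (verts (del_vert v)) < card (verts G)"
          using v by (simp add: card_verts_del_vert_less)
        show "graph (del_vert v)"
          using graph_induced_subgraph[OF less.prems(1) ind] .
        show "set q \<subseteq> verts (del_vert v)"
          using q by (auto simp: verts_del_vert)
        show "successively (\<lambda>x y. (x, y) \<in> arcs_ends (del_vert v)) q"
          using q(4)
          by (rule successively_mono)
            (use q in \<open>auto simp: arcs_ends_induced_subgraph[OF ind] verts_del_vert\<close>)
      qed (use q in auto)
      then show ?thesis by (simp add: Suc)
    qed simp
    then have "d \<le> Min ((\<lambda>v. treedepth (del_vert v)) ` verts G)"
      using hd by (subst Min_ge_iff) auto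
    then show ?thesis
      by (simp add: treedepth_connected[OF less.prems(1) True])
  qed
qed

section \<open>Cycles and trees\<close>

lemma awalk_of_vertices:
  assumes "graph G" "u \<in> verts G" "successively (\<lambda>x y. (x, y) \<in> arcs_ends G) (u # vs)"
  shows "\<exists>p. pre_digraph.awalk G u p (last (u # vs)) \<and> pre_digraph.awalk_verts G u p = u # vs"
proof -
  interpret graph G by fact
  show ?thesis
    using assms(2,3)
  proof (induction vs arbitrary: u)
    case Nil
    then have "awalk u [] u \<and> awalk_verts u [] = [u]"
      by (simp add: awalk_Nil_iff)
    then show ?case by auto
  next
    case (Cons v vs)
    then have "(u, v) \<in> arcs_ends G" by simp
    then obtain e where e: "e \<in> arcs G" "tail G e = u" "head G e = v"
      by auto
    then have "v \<in> verts G" by auto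
    then obtain p where "awalk v p (last (v # vs))" "awalk_verts v p = v # vs"
      using Cons by auto
    then have "awalk u (e # p) (last (u # v # vs)) \<and> awalk_verts u (e # p) = u # v # vs"
      using e by (simp add: awalk_Cons_iff)
    then show ?case by blast
  qed
qed

lemma is_tree_no_cycle:
  assumes "is_tree G" "distinct vs" "3 \<le> length vs"
    and "successively (\<lambda>x y. (x, y) \<in> arcs_ends G) vs" "(last vs, hd vs) \<in> arcs_ends G"
  shows False
proof -
  have G: "graph G"
    using assms(1) by (simp add: is_tree_def)
  then interpret graph G .
  obtain u us where vs: "vs = u # us"
    using assms(3) by (cases vs) auto
  have "u \<in> verts G"
    using arcs_ends_graph(2)[OF G assms(5)] vs by simp
  then obtain p where p: "awalk u p (last vs)" "awalk_verts u p = vs"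
    using awalk_of_vertices[OF G] assms(4) vs by blast
  obtain e where e: "e \<in> arcs G" "tail G e = last vs" "head G e = u"
    using assms(5) vs by auto
  have "awalk (last vs) (e # p) (last vs)"
    using e p(1) by (simp add: awalk_Cons_iff)
  moreover have "tl (awalk_verts (last vs) (e # p)) = vs"
    using e p(2) by simp
  ultimately have "cycle (e # p)"
    unfolding cycle_def using assms(2) by force
  moreover have "3 \<le> length (e # p)"
    using assms(3) p(2) length_awalk_verts[of u p] by simp
  ultimately show False
    using assms(1) unfolding is_tree_def by blast
qed

text \<open>
  The function \<open>f\<close> plays the role of the depth in a rooted tree: every vertex has at most one
  neighbour that is not deeper than itself.
\<close>

lemma is_treeI:
  fixes f :: "'a \<Rightarrow> nat"
  assumes "graph G" "connected G"
    and uniq: "\<And>v u w. \<lbrakk>(v, u) \<in> arcs_ends G; (v, w) \<in> arcs_ends G; f u \<le> f v; f w \<le> f v\<rbrakk> \<Longrightarrow> u = w"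
  shows "is_tree G"
proof -
  interpret graph G by fact
  have False if p: "cycle p" "3 \<le> length p" for p
  proof -
    let ?n = "length p"
    define g where "g i = head G (p ! (i mod ?n))" for i
    from p(1) obtain u where u: "awalk u p u" "distinct (tl (awalk_verts u p))" "p \<noteq> []"
      unfolding cycle_def by blast
    have cas: "cas u p u"
      using u(1) by auto
    have eq: "map (tail G) p @ [head G (last p)] = tail G (hd p) # map (head G) p"
      using awalk_verts_conv[of u p] awalk_verts_conv'[OF cas] u(3) by simp
    have "distinct (map (head G) p)"
      using u(2,3) awalk_verts_conv'[OF cas] by simp
    then have inj: "i mod ?n = j mod ?n" if "g i = g j" for i j
    proof -
      have "map (head G) p ! (i mod ?n) = map (head G) p ! (j mod ?n)"
        using that u(3) by (simp add: g_def)
      with \<open>distinct (map (head G) p)\<close> show ?thesis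
        using u(3) by (subst (asm) nth_eq_iff_index_eq) auto
    qed
    have adj: "(g i, g (Suc i)) \<in> arcs_ends G" for i
    proof -
      let ?k = "i mod ?n"
      have k: "?k < ?n"
        using u(3) by simp
      have "g i = tail G (p ! (Suc i mod ?n))"
      proof (cases "Suc ?k < ?n")
        case True
        then have "tail G (p ! Suc ?k) = head G (p ! ?k)"
          using arg_cong[OF eq, of "\<lambda>xs. xs ! Suc ?k"] k by (simp add: nth_append)
        then show ?thesis
          using True by (simp add: g_def mod_Suc)
      next
        case False
        then have "Suc ?k = ?n"
          using k by simp
        then have "?k = ?n - 1" "Suc i mod ?n = 0"
          by (simp_all add: mod_Suc)
        moreover have "tail G (hd p) = u"
          using cas u(3) by (simp add: cas_simp)
        moreover have "head G (last p) = u"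
          using u(1,3) awalk_verts_conv[of u p] awlast_if_cas[OF cas] by simp
        ultimately show ?thesis
          using u(3) by (simp add: g_def last_conv_nth hd_conv_nth)
      qed
      moreover have "p ! (Suc i mod ?n) \<in> arcs G"
        using u(1,3) by (auto simp: awalk_def subset_iff)
      ultimately show ?thesis
        using in_arcs_imp_in_arcs_ends[of "p ! (Suc i mod ?n)"] by (simp add: g_def)
    qed
    \<comment> \<open>A deepest vertex of the cycle has two distinct neighbours that are not deeper.\<close>
    have "Max ((\<lambda>i. f (g i)) ` {..<?n}) \<in> (\<lambda>i. f (g i)) ` {..<?n}"
      using u(3) by (intro Max_in) auto
    then obtain i where i: "i < ?n" "f (g i) = Max ((\<lambda>i. f (g i)) ` {..<?n})"
      by auto
    have le: "f (g j) \<le> f (g i)" for j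
    proof -
      have "f (g (j mod ?n)) \<le> f (g i)"
        unfolding i(2) using u(3) by (intro Max_ge) auto
      then show ?thesis by (simp add: g_def)
    qed
    have "g (Suc (i + ?n - 1)) = g i"
      using u(3) by (simp add: g_def Suc_diff_Suc)
    then have "(g i, g (i + ?n - 1)) \<in> arcs_ends G"
      using adj[of "i + ?n - 1"] graph_symmetric by simp
    then have "g (i + ?n - 1) = g (Suc i)"
      using uniq[OF _ adj] le by blast
    then have "(i + ?n - 1) mod ?n = Suc i mod ?n"
      by (rule inj)
    then have "?n dvd (i + ?n - 1) - Suc i"
      using p(2) by (subst (asm) mod_eq_dvd_iff_nat) auto
    then show False
      using p(2) by (auto dest: dvd_imp_le)
  qed
  then show ?thesis
    using assms(1,2) by (auto simp: is_tree_def)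
qed

lemma rtrancl_distinct_path:
  assumes "(a, b) \<in> R\<^sup>*"
  shows "\<exists>vs. vs \<noteq> [] \<and> distinct vs \<and> hd vs = a \<and> last vs = b \<and> successively (\<lambda>x y. (x, y) \<in> R) vs"
  using assms
proof induction
  case base
  show ?case by (rule exI[of _ "[a]"]) simp
next
  case (step b c)
  then obtain vs where vs: "vs \<noteq> []" "distinct vs" "hd vs = a" "last vs = b"
      "successively (\<lambda>x y. (x, y) \<in> R) vs"
    by blast
  show ?case
  proof (cases "c \<in> set vs")
    case True
    then obtain xs ys where xs: "vs = xs @ c # ys"
      by (meson split_list)
    show ?thesis
      using vs unfolding xs
      by (intro exI[of _ "xs @ [c]"]) (auto simp: successively_append_iff hd_append split: if_splits)
  next
    case False
    then show ?thesis
      using vs step(2) by (intro exI[of _ "vs @ [c]"]) (auto simp: successively_append_iff)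
  qed
qed

text \<open>
  Both ends of a tree edge cannot reach the same vertex while avoiding the other end: this would
  be a second connection between them.
\<close>

lemma is_tree_bridge:
  assumes "is_tree T" "(x, y) \<in> arcs_ends T"
    and "(y, z) \<in> (arcs_ends T \<inter> (- {x}) \<times> (- {x}))\<^sup>*"
    and "(x, z) \<in> (arcs_ends T \<inter> (- {y}) \<times> (- {y}))\<^sup>*"
  shows False
proof -
  have T: "graph T"
    using assms(1) by (simp add: is_tree_def)
  let ?R = "arcs_ends T - {(x, y), (y, x)}"
  have "sym ?R"
    using arcs_ends_graph(1)[OF T] by (auto intro!: symI)
  then have "sym (?R\<^sup>*)"
    by (rule sym_rtrancl)
  moreover have "(y, z) \<in> ?R\<^sup>*"
    using assms(3) by (rule rtrancl_mono[THEN subsetD, rotated]) auto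
  moreover have "(x, z) \<in> ?R\<^sup>*"
    using assms(4) by (rule rtrancl_mono[THEN subsetD, rotated]) auto
  ultimately have "(y, x) \<in> ?R\<^sup>*"
    by (meson rtrancl_trans symE)
  then obtain vs where vs: "vs \<noteq> []" "distinct vs" "hd vs = y" "last vs = x"
      "successively (\<lambda>u v. (u, v) \<in> ?R) vs"
    using rtrancl_distinct_path by metis
  have "x \<noteq> y"
    using assms(2) arcs_ends_graph(3)[OF T] by auto
  obtain a vs' where vs': "vs = y # a # vs'"
    using vs(1,3,4) \<open>x \<noteq> y\<close> by (cases vs; cases "tl vs") auto
  have "vs' \<noteq> []"
  proof
    assume "vs' = []"
    then show False
      using vs(4,5) vs' by simp
  qed
  then have "3 \<le> length vs"
    unfolding vs' by (cases vs') auto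
  moreover have "successively (\<lambda>u v. (u, v) \<in> arcs_ends T) vs"
    using vs(5) by (rule successively_mono) auto
  ultimately show False
    using is_tree_no_cycle[OF assms(1) vs(2)] vs(3,4) assms(2) by simp
qed

lemma rtrancl_first_step:
  assumes "(x, z) \<in> R\<^sup>*" "x \<noteq> z"
  obtains y where "(x, y) \<in> R" "(y, z) \<in> (R \<inter> (- {x}) \<times> (- {x}))\<^sup>*"
proof -
  have "\<exists>y. (x, y) \<in> R \<and> (y, z) \<in> (R \<inter> (- {x}) \<times> (- {x}))\<^sup>*"
    using assms
  proof (induction rule: rtrancl_induct)
    case (step y z)
    show ?case
    proof (cases "y = x")
      case True
      then show ?thesis using step(2) by blast
    next
      case False
      then obtain w where w: "(x, w) \<in> R" "(w, y) \<in> (R \<inter> (- {x}) \<times> (- {x}))\<^sup>*"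
        using step(3) by auto
      have "(y, z) \<in> R \<inter> (- {x}) \<times> (- {x})"
        using False step by auto
      with w(2) have "(w, z) \<in> (R \<inter> (- {x}) \<times> (- {x}))\<^sup>*"
        by (rule rtrancl_into_rtrancl)
      with w(1) show ?thesis by blast
    qed
  qed simp
  then show ?thesis using that by blast
qed

text \<open>
  If every node of a finite tree points along an edge, then two adjacent nodes point at each other:
  otherwise the orbit of a node would run into a cycle of length at least 3.
\<close>

lemma is_tree_functional_edge:
  assumes "is_tree T" "\<And>x. x \<in> verts T \<Longrightarrow> (x, f x) \<in> arcs_ends T"
  obtains x where "x \<in> verts T" "f (f x) = x"
proof (rule ccontr)
  assume "\<not> thesis"
  then have no: "f (f x) \<noteq> x" if "x \<in> verts T" for x
    using that \<open>\<And>x. x \<in> verts T \<Longrightarrow> f (f x) = x \<Longrightarrow> thesis\<close> by blast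
  have T: "graph T" "connected T"
    using assms(1) by (simp_all add: is_tree_def)
  then interpret graph T by simp
  obtain x0 where x0: "x0 \<in> verts T"
    using T connected_graph_iff by blast
  have closed: "(f ^^ n) x \<in> verts T" if "x \<in> verts T" for n x
    using that arcs_ends_graph(2)[OF T(1)] assms(2) by (induction n) auto
  have "\<not> inj_on (\<lambda>n. (f ^^ n) x0) (UNIV :: nat set)"
    using closed[OF x0] finite_verts
    by (meson finite_imageD finite_subset image_subsetI infinite_UNIV_nat)
  then obtain i j where ij: "i < j" "(f ^^ i) x0 = (f ^^ j) x0"
    unfolding inj_on_def by (metis linorder_neqE_nat)
  define x where "x = (f ^^ i) x0"
  have x: "x \<in> verts T"
    unfolding x_def by (rule closed[OF x0])
  have add: "(f ^^ m) ((f ^^ n) y) = (f ^^ (m + n)) y" for m n y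
    by (simp add: funpow_add)
  have "(f ^^ (j - i)) x = x"
    unfolding x_def add using ij by simp
  then have ex: "\<exists>k. 0 < k \<and> (f ^^ k) x = x"
    using ij(1) by (intro exI[of _ "j - i"]) simp
  define k where "k = (LEAST k. 0 < k \<and> (f ^^ k) x = x)"
  have k: "0 < k" "(f ^^ k) x = x"
    using LeastI_ex[OF ex] unfolding k_def by blast+
  have least: "(f ^^ l) x \<noteq> x" if "0 < l" "l < k" for l
    using that not_less_Least unfolding k_def by blast
  have "k \<noteq> 1"
    using assms(2)[OF x] arcs_ends_graph(3)[OF T(1)] k(2) by auto
  moreover have "k \<noteq> 2"
    using no[OF x] k(2) by (auto simp: numeral_2_eq_2)
  ultimately have "3 \<le> k"
    using k(1) by simp
  let ?vs = "map (\<lambda>n. (f ^^ n) x) [0..<k]"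
  have ne: "(f ^^ m) x \<noteq> (f ^^ n) x" if "m < n" "n < k" for m n
  proof
    assume "(f ^^ m) x = (f ^^ n) x"
    then have "(f ^^ (k - n)) ((f ^^ m) x) = (f ^^ (k - n)) ((f ^^ n) x)"
      by simp
    then have "(f ^^ (k - n + m)) x = (f ^^ k) x"
      unfolding add using that by simp
    moreover have "0 < k - n + m" "k - n + m < k"
      using that by linarith+
    ultimately show False
      using least k(2) by metis
  qed
  have "inj_on (\<lambda>n. (f ^^ n) x) {0..<k}"
    unfolding inj_on_def using ne by (metis atLeastLessThan_iff linorder_neqE_nat)
  then have "distinct ?vs"
    by (simp add: distinct_map)
  moreover have "successively (\<lambda>x y. (x, y) \<in> arcs_ends T) ?vs"
    using assms(2) closed[OF x] by (auto simp: successively_conv_nth)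
  moreover have "(last ?vs, hd ?vs) \<in> arcs_ends T"
  proof -
    have "hd ?vs = x"
      using k(1) by (simp add: hd_conv_nth)
    also have "x = f ((f ^^ (k - 1)) x)"
      using k by (cases k) auto
    finally have "hd ?vs = f ((f ^^ (k - 1)) x)" .
    moreover have "last ?vs = (f ^^ (k - 1)) x"
      using k(1) by (simp add: last_map)
    ultimately show ?thesis
      using assms(2)[OF closed[OF x]] by simp
  qed
  moreover have "3 \<le> length ?vs"
    using \<open>3 \<le> k\<close> by simp
  ultimately show False
    using is_tree_no_cycle[OF assms(1)] by blast
qed

section \<open>Complete minors and treewidth\<close>

text \<open>
  A model of the complete graph on \<open>m\<close> vertices as a minor: \<open>B 0, \<dots>, B (m - 1)\<close> are the branch
  sets, each connected within itself, pairwise disjoint and pairwise joined by an edge.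
\<close>

definition clique_minor :: "('a, 'b) pre_digraph \<Rightarrow> nat \<Rightarrow> (nat \<Rightarrow> 'a set) \<Rightarrow> bool" where
  "clique_minor G m B \<longleftrightarrow>
     (\<forall>i<m. B i \<noteq> {} \<and> B i \<subseteq> verts G \<and>
        (\<forall>u\<in>B i. \<forall>v\<in>B i. (u, v) \<in> (arcs_ends G \<inter> B i \<times> B i)\<^sup>*)) \<and>
     (\<forall>i<m. \<forall>j<m. i \<noteq> j \<longrightarrow> B i \<inter> B j = {} \<and> (\<exists>u\<in>B i. \<exists>v\<in>B j. (u, v) \<in> arcs_ends G))"

text \<open>
  The nodes whose bags meet a given branch set span a subtree, and any two of these subtrees meet.
  If no bag met all branch sets, every node could point towards a subtree that avoids it.  Two
  adjacent nodes pointing at each other would then separate two of the subtrees.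
\<close>

lemma clique_minor_bag:
  assumes "graph G" "tree_decomposition G T W" "clique_minor G m B"
  shows "\<exists>x\<in>verts T. \<forall>i<m. W x \<inter> B i \<noteq> {}"
proof (rule ccontr)
  assume "\<not> ?thesis"
  then have "\<forall>x\<in>verts T. \<exists>i<m. W x \<inter> B i = {}"
    by blast
  then obtain c where c: "\<And>x. x \<in> verts T \<Longrightarrow> c x < m \<and> W x \<inter> B (c x) = {}"
    by metis
  have tree: "is_tree T" and conn: "\<And>u. u \<in> verts G \<Longrightarrow> connected (T \<restriction> {x\<in>verts T. u \<in> W x})"
    and bag: "\<And>u v. (u, v) \<in> arcs_ends G \<Longrightarrow> \<exists>x\<in>verts T. u \<in> W x \<and> v \<in> W x"
    using assms(2) by (auto simp: tree_decomposition_def)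
  have T: "graph T" "connected T"
    using tree by (simp_all add: is_tree_def)
  then interpret T: graph T by simp
  let ?F = "arcs_ends T"
  define S where "S i = {x \<in> verts T. W x \<inter> B i \<noteq> {}}" for i
  have bag1: "\<exists>x\<in>verts T. u \<in> W x" if "u \<in> verts G" for u
    using conn[OF that] connected_graph_iff[of "T \<restriction> {x\<in>verts T. u \<in> W x}"]
      graph_induced_subgraph[OF T(1) T.induced_induce[of "{x\<in>verts T. u \<in> W x}"]] by auto
  have bag_conn: "(x, y) \<in> (?F \<inter> S i \<times> S i)\<^sup>*"
    if "u \<in> B i" "u \<in> verts G" "x \<in> verts T" "y \<in> verts T" "u \<in> W x" "u \<in> W y" for u i x y
  proof -
    let ?X = "{x\<in>verts T. u \<in> W x}"
    have ind: "induced_subgraph (T \<restriction> ?X) T"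
      by (rule T.induced_induce) auto
    have "(x, y) \<in> (arcs_ends (T \<restriction> ?X))\<^sup>*"
      using conn[OF that(2)] connected_graph_iff[OF graph_induced_subgraph[OF T(1) ind]] that
      by simp
    moreover have "arcs_ends (T \<restriction> ?X) \<subseteq> ?F \<inter> S i \<times> S i"
      using that(1) unfolding arcs_ends_induced_subgraph[OF ind] by (auto simp: S_def)
    ultimately show ?thesis
      using rtrancl_mono by blast
  qed
  have S_conn: "(x, y) \<in> (?F \<inter> S i \<times> S i)\<^sup>*" if i: "i < m" and xy: "x \<in> S i" "y \<in> S i" for x y i
  proof -
    obtain u v where uv: "u \<in> W x" "u \<in> B i" "v \<in> W y" "v \<in> B i"
      using xy by (auto simp: S_def)
    have B: "B i \<subseteq> verts G" "(u, v) \<in> (arcs_ends G \<inter> B i \<times> B i)\<^sup>*"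
      using assms(3) i uv by (auto simp: clique_minor_def)
    from B(2) have "\<forall>y\<in>verts T. v \<in> W y \<longrightarrow> (x, y) \<in> (?F \<inter> S i \<times> S i)\<^sup>*"
    proof induction
      case base
      then show ?case
        using bag_conn[OF uv(2)] B(1) uv xy by (auto simp: S_def)
    next
      case (step v w)
      then obtain z where "z \<in> verts T" "v \<in> W z" "w \<in> W z"
        using bag by blast
      moreover have "w \<in> B i" "w \<in> verts G"
        using step(2) B(1) by auto
      ultimately show ?case
        using step(3) bag_conn[of w i z] by (meson rtrancl_trans)
    qed
    then show ?thesis
      using uv xy by (auto simp: S_def)
  qed
  have S_meet: "S i \<inter> S j \<noteq> {}" if ij: "i < m" "j < m" for i j
  proof (cases "i = j")
    case True
    obtain u where "u \<in> B i" "u \<in> verts G"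
      using assms(3) ij(1) unfolding clique_minor_def by blast
    then show ?thesis
      using True bag1[of u] by (auto simp: S_def)
  next
    case False
    then obtain u v where "u \<in> B i" "v \<in> B j" "(u, v) \<in> arcs_ends G"
      using assms(3) ij unfolding clique_minor_def by meson
    then show ?thesis
      using bag[of u v] by (auto simp: S_def)
  qed
  \<comment> \<open>Every node \<open>x\<close> points towards the subtree of the branch set \<open>c x\<close> that its bag misses.\<close>
  have "\<exists>y. (x, y) \<in> ?F \<and> (\<forall>z\<in>S (c x). (y, z) \<in> (?F \<inter> (- {x}) \<times> (- {x}))\<^sup>*)"
    if x: "x \<in> verts T" for x
  proof -
    obtain z where z: "z \<in> S (c x)"
      using S_meet c[OF x] by blast
    have nx: "x \<notin> S (c x)"
      using c[OF x] by (simp add: S_def)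
    have "(x, z) \<in> ?F\<^sup>*"
      using T connected_graph_iff x z by (auto simp: S_def)
    then obtain y where y: "(x, y) \<in> ?F" "(y, z) \<in> (?F \<inter> (- {x}) \<times> (- {x}))\<^sup>*"
      using rtrancl_first_step z nx by metis
    have "(y, z') \<in> (?F \<inter> (- {x}) \<times> (- {x}))\<^sup>*" if z': "z' \<in> S (c x)" for z'
    proof -
      have "(z, z') \<in> (?F \<inter> S (c x) \<times> S (c x))\<^sup>*"
        using S_conn c[OF x] z z' by blast
      then have "(z, z') \<in> (?F \<inter> (- {x}) \<times> (- {x}))\<^sup>*"
        by (rule rtrancl_mono[THEN subsetD, rotated]) (use nx in auto)
      with y(2) show ?thesis by (rule rtrancl_trans)
    qed
    with y(1) show ?thesis by blast
  qed
  then obtain f where f: "\<And>x. x \<in> verts T \<Longrightarrow> (x, f x) \<in> ?F"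
      "\<And>x z. \<lbrakk>x \<in> verts T; z \<in> S (c x)\<rbrakk> \<Longrightarrow> (f x, z) \<in> (?F \<inter> (- {x}) \<times> (- {x}))\<^sup>*"
    by metis
  obtain x where x: "x \<in> verts T" "f (f x) = x"
    using is_tree_functional_edge[OF tree f(1)] by blast
  have fx: "f x \<in> verts T"
    using arcs_ends_graph(2)[OF T(1) f(1)[OF x(1)]] by simp
  obtain z where "z \<in> S (c x)" "z \<in> S (c (f x))"
    using S_meet c x(1) fx by blast
  then show False
    using is_tree_bridge[OF tree f(1)[OF x(1)]] f(2)[OF x(1)] f(2)[OF fx] x(2) by metis
qed

text \<open>A bag that meets \<open>m\<close> disjoint branch sets has at least \<open>m\<close> elements.\<close>

lemma clique_minor_width:
  assumes "graph G" "tree_decomposition G T W" "clique_minor G m B"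
  shows "int m - 1 \<le> decomposition_width T W"
proof -
  interpret graph G by fact
  interpret T: graph T
    using assms(2) by (simp add: tree_decomposition_def is_tree_def)
  obtain x where x: "x \<in> verts T" "\<And>i. i < m \<Longrightarrow> W x \<inter> B i \<noteq> {}"
    using clique_minor_bag[OF assms] by blast
  define g where "g i = (SOME u. u \<in> W x \<inter> B i)" for i
  have g: "g i \<in> W x \<inter> B i" if "i < m" for i
    unfolding g_def some_in_eq by (rule x(2)[OF that])
  have "inj_on g {..<m}"
    using g assms(3) unfolding inj_on_def clique_minor_def
    by (metis IntI Int_iff empty_iff lessThan_iff)
  then have "card (g ` {..<m}) = m"
    by (simp add: card_image)
  moreover have "g ` {..<m} \<subseteq> W x"
    using g by auto
  moreover have "finite (W x)"
    using assms(2) x(1) finite_subset[OF _ finite_verts] by (auto simp: tree_decomposition_def)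
  ultimately have "m \<le> card (W x)"
    by (metis card_mono)
  then have "int m \<le> Max ((\<lambda>x. int (card (W x))) ` verts T)"
    using x(1) by (intro Max_ge_iff[THEN iffD2]) auto
  then show ?thesis
    by (simp add: decomposition_width_def)
qed

text \<open>
  The integers are not well-ordered, so the minimum exists only because of the lower bound.
\<close>

lemma Least_int_ge:
  fixes k :: int
  assumes "P w" "\<And>w. P w \<Longrightarrow> k \<le> w"
  shows "k \<le> (LEAST w. P w)"
proof -
  have "P (k + int (nat (w - k)))"
    using assms by simp
  then have ex: "\<exists>n. P (k + int n)" by blast
  let ?n = "LEAST n. P (k + int n)"
  have "(LEAST w. P w) = k + int ?n"
  proof (rule Least_equality)
    show "P (k + int ?n)"
      using ex by (rule LeastI_ex)
    show "k + int ?n \<le> y" if "P y" for y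
      using Least_le[of "\<lambda>n. P (k + int n)" "nat (y - k)"] assms(2)[OF that] that by simp
  qed
  then show ?thesis by simp
qed

section \<open>Path decompositions from interval representations\<close>

text \<open>The path on the \<open>N + 1\<close> vertices \<open>0, \<dots>, N\<close>.\<close>

definition path_graph :: "nat \<Rightarrow> (nat, nat \<times> nat) pre_digraph" where
  "path_graph N = \<lparr>verts = {..N}, arcs = {(i, j). i \<le> N \<and> j \<le> N \<and> (j = Suc i \<or> i = Suc j)},
     tail = fst, head = snd\<rparr>"

lemma path_graph_simps [simp]:
  "verts (path_graph N) = {..N}"
  "arcs_ends (path_graph N) = {(i, j). i \<le> N \<and> j \<le> N \<and> (j = Suc i \<or> i = Suc j)}"
  by (simp_all add: path_graph_def arcs_ends_conv)

lemma graph_path_graph: "graph (path_graph N)"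
proof -
  have "arcs (path_graph N) \<subseteq> {..N} \<times> {..N}"
    by (auto simp: path_graph_def)
  then have "finite (arcs (path_graph N))"
    by (rule finite_subset) simp
  moreover have "symmetric (path_graph N)"
    by (auto simp: symmetric_def sym_def)
  ultimately show ?thesis
    by unfold_locales (auto simp: path_graph_def arc_to_ends_def)
qed

lemma connected_path_graph_interval:
  assumes "a \<le> b" "b \<le> N"
  shows "connected (path_graph N \<restriction> {a..b})"
proof -
  interpret graph "path_graph N" by (rule graph_path_graph)
  let ?H = "path_graph N \<restriction> {a..b}"
  have ind: "induced_subgraph ?H (path_graph N)"
    using assms by (intro induced_induce) auto
  have E: "arcs_ends ?H = {(i, j). i \<in> {a..b} \<and> j \<in> {a..b} \<and> (j = Suc i \<or> i = Suc j)}"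
    using assms unfolding arcs_ends_induced_subgraph[OF ind] by auto
  have H: "graph ?H"
    using graph_induced_subgraph[OF graph_path_graph ind] .
  have "(a, a + k) \<in> (arcs_ends ?H)\<^sup>*" if "a + k \<le> b" for k
    using that
  proof (induction k)
    case (Suc k)
    then have "(a, a + k) \<in> (arcs_ends ?H)\<^sup>*" by simp
    also have "(a + k, a + Suc k) \<in> arcs_ends ?H"
      using Suc.prems by (simp add: E)
    finally show ?case .
  qed simp
  then have reach: "(a, x) \<in> (arcs_ends ?H)\<^sup>*" if "x \<in> {a..b}" for x
    using that by (metis atLeastAtMost_iff le_iff_add)
  have "sym ((arcs_ends ?H)\<^sup>*)"
    using arcs_ends_graph(1)[OF H] by (intro sym_rtrancl symI)
  then have "(x, y) \<in> (arcs_ends ?H)\<^sup>*" if "x \<in> {a..b}" "y \<in> {a..b}" for x y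
    using reach[OF that(1)] reach[OF that(2)] by (meson rtrancl_trans symE)
  then show ?thesis
    using assms by (simp add: connected_graph_iff[OF H])
qed

lemma is_tree_path_graph: "is_tree (path_graph N)"
proof (rule is_treeI[where f = id])
  interpret graph "path_graph N" by (rule graph_path_graph)
  show "graph (path_graph N)" by (rule graph_path_graph)
  have "path_graph N \<restriction> {0..N} = path_graph N"
    by (auto simp: path_graph_def induce_subgraph_def)
  then show "connected (path_graph N)"
    using connected_path_graph_interval[of 0 N N] by simp
qed auto

lemma vwalk_arcs_upt: "vwalk_arcs [a..<Suc (a + k)] = map (\<lambda>i. (i, Suc i)) [a..<a + k]"
proof (induction k arbitrary: a)
  case (Suc k)
  have "[a..<Suc (a + Suc k)] = a # Suc a # [Suc (Suc a)..<Suc (Suc a + k)]"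
    by (simp add: upt_conv_Cons del: upt_Suc)
  moreover have "[Suc a..<Suc (Suc a + k)] = Suc a # [Suc (Suc a)..<Suc (Suc a + k)]"
    by (simp add: upt_conv_Cons del: upt_Suc)
  moreover have "[a..<a + Suc k] = a # [Suc a..<Suc a + k]"
    by (simp add: upt_conv_Cons del: upt_Suc)
  ultimately show ?case
    using Suc[of "Suc a"] by (simp del: upt_Suc)
qed simp

lemma is_path_path_graph: "is_path (path_graph N)"
  unfolding is_path_def
proof (intro conjI exI)
  show "graph (path_graph N)" by (rule graph_path_graph)
  show "[0..<Suc N] \<noteq> []" "distinct [0..<Suc N]" by simp_all
  show "verts (path_graph N) = set [0..<Suc N]" by auto
  have "set (vwalk_arcs [0..<Suc N]) = {(i, Suc i) |i. i < N}"
    using vwalk_arcs_upt[of 0 N] by auto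
  then show "arcs_ends (path_graph N) =
      set (vwalk_arcs [0..<Suc N]) \<union> (set (vwalk_arcs [0..<Suc N]))\<inverse>"
    by auto
qed

text \<open>
  Every vertex \<open>v\<close> is assigned the interval from \<open>lo v\<close> to \<open>hi v\<close>, and the intervals of adjacent
  vertices intersect (by symmetry one of the two inequalities suffices); the bags of the points
  form a path decomposition.
\<close>

lemma interval_tree_decomposition:
  fixes lo hi :: "'a \<Rightarrow> nat"
  assumes "graph G" "\<And>v. v \<in> verts G \<Longrightarrow> lo v \<le> hi v \<and> hi v \<le> N"
    and "\<And>u v. (u, v) \<in> arcs_ends G \<Longrightarrow> lo u \<le> hi v"
  shows "tree_decomposition G (path_graph N) (\<lambda>x. {v \<in> verts G. lo v \<le> x \<and> x \<le> hi v})"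
  unfolding tree_decomposition_def
proof (intro conjI ballI)
  show "is_tree (path_graph N)" by (rule is_tree_path_graph)
  fix u assume u: "u \<in> verts G"
  have "{x \<in> verts (path_graph N). u \<in> {v \<in> verts G. lo v \<le> x \<and> x \<le> hi v}} = {lo u..hi u}"
    using u assms(2)[OF u] by auto
  then show "connected (path_graph N \<restriction>
      {x \<in> verts (path_graph N). u \<in> {v \<in> verts G. lo v \<le> x \<and> x \<le> hi v}})"
    using connected_path_graph_interval assms(2)[OF u] by simp
next
  fix e assume "e \<in> arcs_ends G"
  then obtain u v where e: "e = (u, v)" "(u, v) \<in> arcs_ends G" by (cases e) auto
  have uv: "u \<in> verts G" "v \<in> verts G" "lo u \<le> hi v" "lo v \<le> hi u"
    using e(2) arcs_ends_graph(1,2)[OF assms(1) e(2)] assms(3) by auto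
  have "max (lo u) (lo v) \<in> verts (path_graph N)"
    using assms(2) uv by fastforce
  then show "case e of (u, v) \<Rightarrow> \<exists>x\<in>verts (path_graph N).
      u \<in> {v \<in> verts G. lo v \<le> x \<and> x \<le> hi v} \<and> v \<in> {v \<in> verts G. lo v \<le> x \<and> x \<le> hi v}"
    using uv assms(2) unfolding e(1) prod.case
    by (intro bexI[of _ "max (lo u) (lo v)"]) auto
qed auto

lemma pathwidth_eq:
  fixes lo hi :: "'a \<Rightarrow> nat"
  assumes "graph G" "\<And>v. v \<in> verts G \<Longrightarrow> lo v \<le> hi v \<and> hi v \<le> N"
    and "\<And>u v. (u, v) \<in> arcs_ends G \<Longrightarrow> lo u \<le> hi v"
    and "\<And>x. card {v \<in> verts G. lo v \<le> x \<and> x \<le> hi v} \<le> Suc w"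
    and "clique_minor G (Suc w) B"
  shows "pathwidth G = int w"
proof -
  define W where "W x = {v \<in> verts G. lo v \<le> x \<and> x \<le> hi v}" for x
  have td: "tree_decomposition G (path_graph N) W"
    unfolding W_def using interval_tree_decomposition[OF assms(1-3)] .
  have lower: "int w \<le> v" if "tree_decomposition G T U" "decomposition_width T U = v" for T U v
    using clique_minor_width[OF assms(1) that(1) assms(5)] that(2) by simp
  have "int (card (W x)) \<le> int w + 1" for x
    using assms(4)[of x] unfolding W_def by linarith
  then have "Max ((\<lambda>x. int (card (W x))) ` verts (path_graph N)) \<le> int w + 1"
    by (subst Max_le_iff) auto
  then have "decomposition_width (path_graph N) W \<le> int w"
    unfolding decomposition_width_def by linarith
  with lower[OF td refl] have "decomposition_width (path_graph N) W = int w"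
    by simp
  then show ?thesis
    unfolding pathwidth_def using td is_path_path_graph lower
    by (intro Least_equality) blast+
qed

lemma treewidth_ge:
  assumes "graph G" "clique_minor G (Suc w) B"
  shows "int w \<le> treewidth G"
  unfolding treewidth_def
proof (rule Least_int_ge)
  \<comment> \<open>A single bag with all vertices shows that there is a tree decomposition at all.\<close>
  show "\<exists>T W. tree_decomposition G T W \<and>
      decomposition_width T W = decomposition_width (path_graph 0) (\<lambda>x. {v \<in> verts G. 0 \<le> x \<and> x \<le> (0::nat)})"
    using interval_tree_decomposition[OF assms(1), of "\<lambda>_. 0" "\<lambda>_. 0" 0] by blast
  show "int w \<le> v" if "\<exists>T W. tree_decomposition G T W \<and> decomposition_width T W = v" for v
    using that clique_minor_width[OF assms(1) _ assms(2)] by fastforce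
qed

section \<open>Isometric subgraphs\<close>

text \<open>
  A retraction that maps every edge to an edge or to a single vertex turns a walk into a walk of
  at most the same length in the subgraph.
\<close>

lemma isometric_subgraph_retract:
  assumes "graph G" "graph H" "connected H" "subgraph H G"
    and retr: "\<And>v. v \<in> verts H \<Longrightarrow> \<phi> v = v"
    and verts: "\<And>v. v \<in> verts G \<Longrightarrow> \<phi> v \<in> verts H"
    and arcs: "\<And>u v. (u, v) \<in> arcs_ends G \<Longrightarrow> \<phi> u = \<phi> v \<or> (\<phi> u, \<phi> v) \<in> arcs_ends H"
  shows "isometric_subgraph H G"
proof -
  interpret G: graph G by fact
  interpret H: graph H by fact
  have dist: "graph_dist H u v = graph_dist G u v" if uv: "u \<in> verts H" "v \<in> verts H" for u v
  proof -
    have proj: "\<exists>q. H.awalk (\<phi> u) q (\<phi> v) \<and> length q \<le> length p" if "G.awalk u p v" for u p v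
      using that
    proof (induction p arbitrary: u)
      case Nil
      then have "H.awalk (\<phi> u) [] (\<phi> v)"
        using verts by (auto simp: G.awalk_Nil_iff H.awalk_Nil_iff)
      then show ?case by auto
    next
      case (Cons e p)
      then have e: "e \<in> arcs G" "u = tail G e" "G.awalk (head G e) p v"
        by (simp_all add: G.awalk_Cons_iff)
      obtain q where q: "H.awalk (\<phi> (head G e)) q (\<phi> v)" "length q \<le> length p"
        using Cons.IH[OF e(3)] by blast
      have "(u, head G e) \<in> arcs_ends G"
        using e by (simp add: G.in_arcs_imp_in_arcs_ends)
      then consider "\<phi> u = \<phi> (head G e)" | "(\<phi> u, \<phi> (head G e)) \<in> arcs_ends H"
        using arcs by blast
      then show ?case
      proof cases
        case 1
        then show ?thesis using q by auto
      next
        case 2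
        then obtain d where "d \<in> arcs H" "tail H d = \<phi> u" "head H d = \<phi> (head G e)"
          by auto
        then have "H.awalk (\<phi> u) (d # q) (\<phi> v)"
          using q by (simp add: H.awalk_Cons_iff)
        then show ?thesis using q(2) by (intro exI[of _ "d # q"]) simp
      qed
    qed
    have len: "length (H.awalk_to_apath q) \<le> length q" if "H.awalk u q v" for q
    proof -
      have "distinct (H.awalk_to_apath q)"
        using H.apath_awalk_to_apath[OF that] H.distinct_verts_imp_distinct
        by (auto simp: H.apath_def)
      then show ?thesis
        using card_mono[OF _ H.awalk_to_apath_subset[OF that]] card_length[of q]
        by (simp add: distinct_card)
    qed
    have *: "\<exists>q. H.apath u q v \<and> length q \<le> length p" if "G.apath u p v" for p
    proof -
      have "G.awalk u p v"
        using that by (rule G.awalkI_apath)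
      then obtain q where "H.awalk u q v" "length q \<le> length p"
        using proj retr uv by metis
      then show ?thesis
        using H.apath_awalk_to_apath len le_trans by metis
    qed
    have sub: "G.apath u p v" if "H.apath u p v" for p
      using G.subgraph_apath_imp_apath[OF that assms(4)] .
    have "(u, v) \<in> (arcs_ends H)\<^sup>*"
      using assms(2,3) uv by (simp add: connected_graph_iff)
    then have ex: "\<exists>p. H.apath u p v"
      using uv by (simp add: H.reachable_conv' flip: H.reachable_apath)
    let ?G = "LEAST n. \<exists>p. G.apath u p v \<and> length p = n"
    let ?H = "LEAST n. \<exists>p. H.apath u p v \<and> length p = n"
    obtain p where p: "H.apath u p v" "length p = ?H"
      using LeastI_ex[of "\<lambda>n. \<exists>p. H.apath u p v \<and> length p = n"] ex by blast
    obtain q where q: "G.apath u q v" "length q = ?G"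
      using LeastI_ex[of "\<lambda>n. \<exists>p. G.apath u p v \<and> length p = n"] sub ex by blast
    have "?G \<le> ?H"
      using p sub by (metis (mono_tags, lifting) Least_le)
    moreover have "?H \<le> ?G"
      using *[OF q(1)] q(2) by (metis (mono_tags, lifting) Least_le le_trans)
    ultimately show ?thesis
      by (simp add: graph_dist_def)
  qed
  then show ?thesis
    using assms by (simp add: isometric_subgraph_def)
qed

section \<open>Graphs on countable types\<close>

text \<open>
  The graph induced by the relation \<open>R\<close> on the set \<open>S\<close>, whose vertices are renamed to natural
  numbers by the injection \<^const>\<open>to_nat\<close> of the countable type.  The lemmas below transfer the
  criteria of the previous sections to such graphs.
\<close>

definition code_graph ::
  "('v::countable \<Rightarrow> 'v \<Rightarrow> bool) \<Rightarrow> 'v set \<Rightarrow> (nat, nat \<times> nat) pre_digraph" where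
  "code_graph R S = \<lparr>verts = to_nat ` S,
     arcs = {(to_nat u, to_nat v) |u v. u \<in> S \<and> v \<in> S \<and> R u v}, tail = fst, head = snd\<rparr>"

text \<open>The condition under which \<^term>\<open>code_graph R S\<close> is a finite simple undirected graph.\<close>

definition simple_on :: "('v \<Rightarrow> 'v \<Rightarrow> bool) \<Rightarrow> 'v set \<Rightarrow> bool" where
  "simple_on R S \<longleftrightarrow> finite S \<and> symp R \<and> irreflp R"

lemma simple_onD:
  assumes "simple_on R S"
  shows "finite S" "symp R" "R u v \<longleftrightarrow> R v u" "\<not> R u u"
  using assms by (auto simp: simple_on_def irreflp_def symp_def)

lemma simple_on_subset: "simple_on R S \<Longrightarrow> S' \<subseteq> S \<Longrightarrow> simple_on R S'"
  using finite_subset by (auto simp: simple_on_def)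

lemma verts_code_graph [simp]: "verts (code_graph R S) = to_nat ` S"
  by (simp add: code_graph_def)

lemma arcs_ends_code_graph:
  "arcs_ends (code_graph R S) = {(to_nat u, to_nat v) |u v. u \<in> S \<and> v \<in> S \<and> R u v}"
  by (auto simp: code_graph_def arcs_ends_conv)

lemma arcs_ends_code_graph_iff [simp]:
  "(to_nat u, to_nat v) \<in> arcs_ends (code_graph R S) \<longleftrightarrow> u \<in> S \<and> v \<in> S \<and> R u v"
  by (auto simp: arcs_ends_code_graph)

lemma arcs_ends_code_graphE:
  assumes "(a, b) \<in> arcs_ends (code_graph R S)"
  obtains u v where "a = to_nat u" "b = to_nat v" "u \<in> S" "v \<in> S" "R u v"
  using assms by (auto simp: arcs_ends_code_graph)

lemma graph_code_graph:
  assumes "simple_on R S"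
  shows "graph (code_graph R S)"
proof -
  have "arcs (code_graph R S) \<subseteq> to_nat ` S \<times> to_nat ` S"
    by (auto simp: code_graph_def)
  then have "finite (arcs (code_graph R S))"
    by (rule finite_subset) (simp add: simple_onD(1)[OF assms])
  moreover have "symmetric (code_graph R S)"
    using simple_onD(3)[OF assms] unfolding symmetric_def sym_def arcs_ends_code_graph by blast
  moreover have "fst e \<noteq> snd e" if "e \<in> arcs (code_graph R S)" for e
    using that simple_onD(4)[OF assms] by (auto simp: code_graph_def)
  moreover have "finite S"
    using assms by (rule simple_onD(1))
  ultimately show ?thesis
    by unfold_locales (auto simp: code_graph_def arc_to_ends_def)
qed

lemma subgraph_code_graph:
  assumes "simple_on R S" "S' \<subseteq> S"
  shows "subgraph (code_graph R S') (code_graph R S)"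
proof -
  interpret G: graph "code_graph R S"
    using assms(1) by (rule graph_code_graph)
  interpret H: graph "code_graph R S'"
    using simple_on_subset[OF assms] by (rule graph_code_graph)
  have "arcs (code_graph R S') \<subseteq> arcs (code_graph R S)"
    "compatible (code_graph R S) (code_graph R S')"
    using assms(2) by (auto simp: code_graph_def compatible_def)
  then show ?thesis
    using assms(2) G.wf_digraph H.wf_digraph by (intro subgraphI) auto
qed

lemma rtrancl_code_graph:
  assumes "(u, v) \<in> {(u, v). u \<in> S \<and> v \<in> S \<and> R u v}\<^sup>*" "S \<subseteq> S'"
  shows "(to_nat u, to_nat v) \<in> (arcs_ends (code_graph R S') \<inter> to_nat ` S \<times> to_nat ` S)\<^sup>*"
  using assms(1)
proof induction
  case (step v w)
  have "(to_nat v, to_nat w) \<in> arcs_ends (code_graph R S') \<inter> to_nat ` S \<times> to_nat ` S"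
    using step(2) assms(2) by auto
  with step(3) show ?case
    by (rule rtrancl_into_rtrancl)
qed simp

text \<open>
  Some element of \<open>S\<close> reaches all of \<open>S\<close> by steps of \<open>R\<close> inside \<open>S\<close>.  For symmetric \<open>R\<close> this is
  connectedness of the induced graph.
\<close>

definition rooted :: "('v \<Rightarrow> 'v \<Rightarrow> bool) \<Rightarrow> 'v set \<Rightarrow> bool" where
  "rooted R S \<longleftrightarrow> (\<exists>r\<in>S. \<forall>v\<in>S. (r, v) \<in> {(u, v). u \<in> S \<and> v \<in> S \<and> R u v}\<^sup>*)"

lemma rooted_reachable:
  assumes "symp R" "rooted R S" "u \<in> S" "v \<in> S"
  shows "(u, v) \<in> {(u, v). u \<in> S \<and> v \<in> S \<and> R u v}\<^sup>*"
proof -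
  let ?E = "{(u, v). u \<in> S \<and> v \<in> S \<and> R u v}"
  obtain r where r: "\<And>v. v \<in> S \<Longrightarrow> (r, v) \<in> ?E\<^sup>*"
    using assms(2) by (auto simp: rooted_def)
  have "sym (?E\<^sup>*)"
    using assms(1) by (intro sym_rtrancl symI) (auto simp: symp_def)
  then show ?thesis
    using r[OF assms(3)] r[OF assms(4)] by (meson rtrancl_trans symE)
qed

lemma connected_code_graph:
  assumes "simple_on R S" "rooted R S"
  shows "connected (code_graph R S)"
proof -
  have "(to_nat u, to_nat v) \<in> (arcs_ends (code_graph R S))\<^sup>*" if "u \<in> S" "v \<in> S" for u v
  proof -
    have "(u, v) \<in> {(u, v). u \<in> S \<and> v \<in> S \<and> R u v}\<^sup>*"
      using assms that by (intro rooted_reachable) (auto simp: simple_on_def)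
    then have "(to_nat u, to_nat v) \<in> (arcs_ends (code_graph R S) \<inter> to_nat ` S \<times> to_nat ` S)\<^sup>*"
      by (rule rtrancl_code_graph) simp
    then show ?thesis
      by (rule rtrancl_mono[THEN subsetD, rotated]) simp
  qed
  then show ?thesis
    using assms by (auto simp: connected_graph_iff[OF graph_code_graph] rooted_def)
qed

lemma clique_minor_code_graph:
  assumes "simple_on R S"
    and "\<And>i. i < m \<Longrightarrow> B i \<subseteq> S \<and> rooted R (B i)"
    and "\<And>i j. \<lbrakk>i < m; j < m; i \<noteq> j\<rbrakk> \<Longrightarrow> B i \<inter> B j = {} \<and> (\<exists>u\<in>B i. \<exists>v\<in>B j. R u v)"
  shows "clique_minor (code_graph R S) m (\<lambda>i. to_nat ` B i)"
  unfolding clique_minor_def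
proof (intro conjI allI impI ballI)
  fix i assume i: "i < m"
  show "to_nat ` B i \<noteq> {}"
    using assms(2)[OF i] by (auto simp: rooted_def)
  show "to_nat ` B i \<subseteq> verts (code_graph R S)"
    using assms(2)[OF i] by auto
  fix a b assume "a \<in> to_nat ` B i" "b \<in> to_nat ` B i"
  then obtain u v where uv: "a = to_nat u" "b = to_nat v" "u \<in> B i" "v \<in> B i"
    by auto
  have "(u, v) \<in> {(u, v). u \<in> B i \<and> v \<in> B i \<and> R u v}\<^sup>*"
    using assms(1) assms(2)[OF i] uv by (intro rooted_reachable) (auto simp: simple_on_def)
  then show "(a, b) \<in> (arcs_ends (code_graph R S) \<inter> to_nat ` B i \<times> to_nat ` B i)\<^sup>*"
    unfolding uv(1,2) by (rule rtrancl_code_graph) (use assms(2)[OF i] in simp)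
next
  fix i j assume ij: "i < m" "j < m" "i \<noteq> j"
  show "to_nat ` B i \<inter> to_nat ` B j = {}"
    using assms(3)[OF ij] by (auto simp: disjoint_iff)
  obtain u v where uv: "u \<in> B i" "v \<in> B j" "R u v"
    using assms(3)[OF ij] by blast
  then have "(to_nat u, to_nat v) \<in> arcs_ends (code_graph R S)"
    using assms(2)[OF ij(1)] assms(2)[OF ij(2)] by auto
  then show "\<exists>a\<in>to_nat ` B i. \<exists>b\<in>to_nat ` B j. (a, b) \<in> arcs_ends (code_graph R S)"
    using uv(1,2) by blast
qed

lemma rooted_singleton: "rooted R {v}"
  by (simp add: rooted_def)

lemma clique_minor_triangleI:
  assumes "simple_on R S" "B0 \<subseteq> S" "B1 \<subseteq> S" "B2 \<subseteq> S" "rooted R B0" "rooted R B1" "rooted R B2"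
    and "B0 \<inter> B1 = {}" "B0 \<inter> B2 = {}" "B1 \<inter> B2 = {}"
    and "\<exists>u\<in>B0. \<exists>v\<in>B1. R u v" "\<exists>u\<in>B0. \<exists>v\<in>B2. R u v" "\<exists>u\<in>B1. \<exists>v\<in>B2. R u v"
  shows "\<exists>B. clique_minor (code_graph R S) (Suc 2) B"
proof -
  have "symp R"
    using assms(1) by (simp add: simple_on_def)
  then have sym: "\<exists>u\<in>B1. \<exists>v\<in>B0. R u v" "\<exists>u\<in>B2. \<exists>v\<in>B0. R u v" "\<exists>u\<in>B2. \<exists>v\<in>B1. R u v"
    using assms(11-13) by (meson sympD)+
  define B where "B = (\<lambda>i. if i = 0 then B0 else if i = Suc 0 then B1 else B2)"
  have "clique_minor (code_graph R S) (Suc 2) (\<lambda>i. to_nat ` B i)"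
  proof (rule clique_minor_code_graph[OF assms(1)])
    show "B i \<subseteq> S \<and> rooted R (B i)" for i
      using assms by (simp add: B_def)
    show "B i \<inter> B j = {} \<and> (\<exists>u\<in>B i. \<exists>v\<in>B j. R u v)"
      if "i < Suc 2" "j < Suc 2" "i \<noteq> j" for i j
      using that assms(8-13) sym by (auto simp: B_def less_Suc_eq numeral_2_eq_2)
  qed
  then show ?thesis by blast
qed

lemma is_tree_code_graph:
  fixes f :: "'v::countable \<Rightarrow> nat"
  assumes "simple_on R S" "rooted R S"
    and "\<And>v u w. \<lbrakk>v \<in> S; u \<in> S; w \<in> S; R v u; R v w; f u \<le> f v; f w \<le> f v\<rbrakk> \<Longrightarrow> u = w"
  shows "is_tree (code_graph R S)"
proof (rule is_treeI[where f = "\<lambda>a. f (from_nat a)"])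
  show "graph (code_graph R S)"
    using assms(1) by (rule graph_code_graph)
  show "connected (code_graph R S)"
    using assms(1,2) by (rule connected_code_graph)
  fix a b c
  assume "(a, b) \<in> arcs_ends (code_graph R S)" "(a, c) \<in> arcs_ends (code_graph R S)"
    and le: "f (from_nat b) \<le> f (from_nat a)" "f (from_nat c) \<le> f (from_nat a)"
  then obtain v u w where "a = to_nat v" "b = to_nat u" "c = to_nat w"
      "v \<in> S" "u \<in> S" "w \<in> S" "R v u" "R v w"
    by (elim arcs_ends_code_graphE) auto
  then show "b = c"
    using le assms(3)[of v u w] by simp
qed

lemma treedepth_code_graph_le:
  fixes l :: "'v::countable \<Rightarrow> 'c list"
  assumes "simple_on R S" "inj_on l S"
    and "\<And>u v. \<lbrakk>u \<in> S; v \<in> S; R u v\<rbrakk> \<Longrightarrow> prefix (l u) (l v) \<or> prefix (l v) (l u)"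
    and "\<And>v. v \<in> S \<Longrightarrow> l v \<noteq> [] \<and> length (l v) \<le> d"
  shows "treedepth (code_graph R S) \<le> d"
proof (rule treedepth_le[where l = "\<lambda>a. l (from_nat a)"])
  show "graph (code_graph R S)"
    using assms(1) by (rule graph_code_graph)
  show "inj_on (\<lambda>a. l (from_nat a)) (verts (code_graph R S))"
    using assms(2) by (auto simp: inj_on_def)
  show "prefix (l (from_nat a)) (l (from_nat b)) \<or> prefix (l (from_nat b)) (l (from_nat a))"
    if "(a, b) \<in> arcs_ends (code_graph R S)" for a b
    using that by (elim arcs_ends_code_graphE) (simp add: assms(3))
  show "l (from_nat a) \<noteq> [] \<and> length (l (from_nat a)) \<le> d" if "a \<in> verts (code_graph R S)" for a
    using that assms(4) by auto
qed

lemma treedepth_code_graph_gt: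
  assumes "simple_on R S" "distinct p" "set p \<subseteq> S" "successively R p" "2 ^ d \<le> length p"
  shows "d < treedepth (code_graph R S)"
proof (rule treedepth_gt[where p = "map to_nat p"])
  show "graph (code_graph R S)"
    using assms(1) by (rule graph_code_graph)
  show "distinct (map to_nat p)"
    using assms(2) by (simp add: distinct_map)
  show "set (map to_nat p) \<subseteq> verts (code_graph R S)"
    using assms(3) by auto
  show "successively (\<lambda>u v. (u, v) \<in> arcs_ends (code_graph R S)) (map to_nat p)"
    unfolding successively_map using assms(4) by (rule successively_mono) (use assms(3) in auto)
qed (use assms(5) in simp)

lemma pathwidth_code_graph_eq:
  fixes lo hi :: "'v::countable \<Rightarrow> nat"
  assumes "simple_on R S" "\<And>v. v \<in> S \<Longrightarrow> lo v \<le> hi v \<and> hi v \<le> N"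
    and "\<And>u v. \<lbrakk>u \<in> S; v \<in> S; R u v\<rbrakk> \<Longrightarrow> lo u \<le> hi v"
    and "\<And>t. card {v \<in> S. lo v \<le> t \<and> t \<le> hi v} \<le> Suc w"
    and "clique_minor (code_graph R S) (Suc w) B"
  shows "pathwidth (code_graph R S) = int w"
proof (rule pathwidth_eq[where lo = "\<lambda>a. lo (from_nat a)" and hi = "\<lambda>a. hi (from_nat a)"])
  show "graph (code_graph R S)"
    using assms(1) by (rule graph_code_graph)
  show "lo (from_nat a) \<le> hi (from_nat a) \<and> hi (from_nat a) \<le> N" if "a \<in> verts (code_graph R S)" for a
    using that assms(2) by auto
  show "lo (from_nat a) \<le> hi (from_nat b)" if "(a, b) \<in> arcs_ends (code_graph R S)" for a b
    using that by (elim arcs_ends_code_graphE) (simp add: assms(3))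
  fix t
  have "{a \<in> verts (code_graph R S). lo (from_nat a) \<le> t \<and> t \<le> hi (from_nat a)}
      = to_nat ` {v \<in> S. lo v \<le> t \<and> t \<le> hi v}"
    by auto
  then show "card {a \<in> verts (code_graph R S). lo (from_nat a) \<le> t \<and> t \<le> hi (from_nat a)} \<le> Suc w"
    using assms(4)[of t] by (simp add: card_image)
qed (fact assms(5))

lemma isometric_code_graph:
  assumes "simple_on R S" "S' \<subseteq> S" "rooted R S'"
    and "\<And>v. v \<in> S' \<Longrightarrow> \<phi> v = v" "\<And>v. v \<in> S \<Longrightarrow> \<phi> v \<in> S'"
    and "\<And>u v. \<lbrakk>u \<in> S; v \<in> S; R u v\<rbrakk> \<Longrightarrow> \<phi> u = \<phi> v \<or> R (\<phi> u) (\<phi> v)"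
  shows "isometric_subgraph (code_graph R S') (code_graph R S)"
proof (rule isometric_subgraph_retract[where \<phi> = "\<lambda>a. to_nat (\<phi> (from_nat a))"])
  have simp': "simple_on R S'"
    using assms(1,2) by (rule simple_on_subset)
  show "graph (code_graph R S)" "graph (code_graph R S')"
    using assms(1) simp' by (simp_all add: graph_code_graph)
  show "connected (code_graph R S')"
    using simp' assms(3) by (rule connected_code_graph)
  show "subgraph (code_graph R S') (code_graph R S)"
    using assms(1,2) by (rule subgraph_code_graph)
  show "to_nat (\<phi> (from_nat a)) = a" if "a \<in> verts (code_graph R S')" for a
    using that assms(4) by auto
  show "to_nat (\<phi> (from_nat a)) \<in> verts (code_graph R S')" if "a \<in> verts (code_graph R S)" for a
    using that assms(5) by auto
  show "to_nat (\<phi> (from_nat a)) = to_nat (\<phi> (from_nat b)) \<or>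
      (to_nat (\<phi> (from_nat a)), to_nat (\<phi> (from_nat b))) \<in> arcs_ends (code_graph R S')"
    if "(a, b) \<in> arcs_ends (code_graph R S)" for a b
    using that
  proof (elim arcs_ends_code_graphE)
    fix u v assume "a = to_nat u" "b = to_nat v" "u \<in> S" "v \<in> S" "R u v"
    then show ?thesis
      using assms(6)[of u v] assms(5)[of u] assms(5)[of v] by auto
  qed
qed

section \<open>Subdivided graphs with an apex for every colour\<close>

text \<open>
  \<open>Apex c\<close> is the apex of colour \<open>c\<close>, \<open>Orig x\<close> a base vertex, and \<open>Mid x y\<close> the vertex that
  subdivides the base edge given by the arc from \<open>x\<close> to \<open>y\<close>.
\<close>

datatype 'b vert = Apex nat | Orig 'b | Mid 'b 'b

instance vert :: (countable) countable
  by countable_datatype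

text \<open>
  The edges, each in one direction only.  The flag \<open>full\<close> tells whether an apex is also joined to
  the subdivision vertices of the base edges that have an end of its colour.
\<close>

fun link :: "('b \<Rightarrow> nat) \<Rightarrow> bool \<Rightarrow> 'b vert \<Rightarrow> 'b vert \<Rightarrow> bool" where
  "link col full (Apex c) (Orig x) \<longleftrightarrow> col x = c"
| "link col full (Apex c) (Mid x y) \<longleftrightarrow> full \<and> (col x = c \<or> col y = c)"
| "link col full (Orig z) (Mid x y) \<longleftrightarrow> z = x \<or> z = y"
| "link col full u v \<longleftrightarrow> False"

lemma linkE:
  assumes "link col full u v"
  obtains (orig) c x where "u = Apex c" "v = Orig x" "col x = c"
    | (mid) c x y where "u = Apex c" "v = Mid x y" "full" "col x = c \<or> col y = c"
    | (inc) z x y where "u = Orig z" "v = Mid x y" "z = x \<or> z = y"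
  using assms by (cases u; cases v) auto

lemma card_le_Suc_0I:
  assumes "\<And>u v. \<lbrakk>u \<in> A; v \<in> A\<rbrakk> \<Longrightarrow> u = v"
  shows "card A \<le> Suc 0"
  using assms by (cases "finite A") (auto simp: card_le_Suc0_iff_eq)

text \<open>
  A base graph on the vertex set \<open>X\<close>, whose edges are given by the arcs \<open>A\<close> in one of the two
  possible orientations, with a colouring (not necessarily proper) by the colours \<open>1, \<dots>, k\<close>.
\<close>

locale coloured_digraph =
  fixes X :: "'b::countable set" and A :: "('b \<times> 'b) set"
    and col :: "'b \<Rightarrow> nat" and full :: bool and k :: nat
  assumes finite_X: "finite X"
    and A_sub: "(x, y) \<in> A \<Longrightarrow> x \<in> X \<and> y \<in> X"
    and A_asym: "(x, y) \<in> A \<Longrightarrow> (y, x) \<notin> A"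
    and col_range: "x \<in> X \<Longrightarrow> col x \<in> {1..k}"
begin

text \<open>Adjacency in the subdivided graph with apices.\<close>

definition adj :: "'b vert \<Rightarrow> 'b vert \<Rightarrow> bool" where
  "adj u v \<longleftrightarrow> link col full u v \<or> link col full v u"

lemma adj_simps [simp]:
  "adj (Apex c) (Apex d) \<longleftrightarrow> False"
  "adj (Apex c) (Orig x) \<longleftrightarrow> col x = c"
  "adj (Orig x) (Apex c) \<longleftrightarrow> col x = c"
  "adj (Apex c) (Mid x y) \<longleftrightarrow> full \<and> (col x = c \<or> col y = c)"
  "adj (Mid x y) (Apex c) \<longleftrightarrow> full \<and> (col x = c \<or> col y = c)"
  "adj (Orig z) (Orig z') \<longleftrightarrow> False"
  "adj (Orig z) (Mid x y) \<longleftrightarrow> z = x \<or> z = y"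
  "adj (Mid x y) (Orig z) \<longleftrightarrow> z = x \<or> z = y"
  "adj (Mid x y) (Mid x' y') \<longleftrightarrow> False"
  by (auto simp: adj_def)

lemma adj_sym: "adj u v \<longleftrightarrow> adj v u"
  by (auto simp: adj_def)

lemma adj_Apex_Mid:
  assumes full
  shows "adj (Apex c) (Mid x y) \<longleftrightarrow> col x = c \<or> col y = c"
    and "adj (Mid x y) (Apex c) \<longleftrightarrow> col x = c \<or> col y = c"
  unfolding adj_simps using assms by blast+

lemma not_adj_Apex_Mid:
  assumes "\<not> full"
  shows "\<not> adj (Apex c) (Mid x y)" and "\<not> adj (Mid x y) (Apex c)"
  unfolding adj_simps using assms by blast+

text \<open>
  The vertices of the whole graph \<open>G\<close>, and those of its induced subgraph \<open>H c\<close> that belongs to the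
  colour \<open>c\<close>.
\<close>

definition V :: "'b vert set" where
  "V = Apex ` {1..k} \<union> Orig ` X \<union> (\<lambda>(x, y). Mid x y) ` A"

definition class_verts :: "nat \<Rightarrow> 'b vert set" where
  "class_verts c = {Apex c} \<union> Orig ` {x \<in> X. col x = c} \<union>
     (\<lambda>(x, y). Mid x y) ` {(x, y) \<in> A. col x = c \<or> col y = c}"

lemma in_V [simp]:
  "Apex c \<in> V \<longleftrightarrow> c \<in> {1..k}"
  "Orig x \<in> V \<longleftrightarrow> x \<in> X"
  "Mid x y \<in> V \<longleftrightarrow> (x, y) \<in> A"
  by (auto simp: V_def)

lemma in_class_verts [simp]:
  "Apex d \<in> class_verts c \<longleftrightarrow> d = c"
  "Orig x \<in> class_verts c \<longleftrightarrow> x \<in> X \<and> col x = c"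
  "Mid x y \<in> class_verts c \<longleftrightarrow> (x, y) \<in> A \<and> (col x = c \<or> col y = c)"
  by (auto simp: class_verts_def)

definition G :: "(nat, nat \<times> nat) pre_digraph" where
  "G = code_graph adj V"

definition H :: "nat \<Rightarrow> (nat, nat \<times> nat) pre_digraph" where
  "H c = code_graph adj (class_verts c)"

lemma simple_V: "simple_on adj V"
proof -
  have "finite A"
    by (rule finite_subset[of _ "X \<times> X"]) (use A_sub finite_X in auto)
  then have "finite V"
    by (simp add: V_def finite_X)
  moreover have "irreflp adj"
  proof (rule irreflpI)
    show "\<not> adj u u" for u by (cases u) auto
  qed
  ultimately show ?thesis
    by (auto simp: simple_on_def symp_def adj_def)
qed

lemma class_verts_subset:
  assumes "c \<in> {1..k}"
  shows "class_verts c \<subseteq> V"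
proof
  show "u \<in> V" if "u \<in> class_verts c" for u
    using that assms by (cases u) auto
qed

lemma simple_class_verts: "c \<in> {1..k} \<Longrightarrow> simple_on adj (class_verts c)"
  using simple_on_subset[OF simple_V class_verts_subset] .

lemma graph_G: "graph G"
  unfolding G_def using simple_V by (rule graph_code_graph)

lemma graph_H: "c \<in> {1..k} \<Longrightarrow> graph (H c)"
  unfolding H_def using simple_class_verts by (rule graph_code_graph)

lemma rooted_class_verts: "rooted adj (class_verts c)"
  unfolding rooted_def
proof (intro bexI ballI)
  let ?E = "{(u, v). u \<in> class_verts c \<and> v \<in> class_verts c \<and> adj u v}"
  show "Apex c \<in> class_verts c" by simp
  have orig: "(Apex c, Orig x) \<in> ?E\<^sup>*" if "x \<in> X" "col x = c" for x
    using that by (intro r_into_rtrancl) simp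
  fix v assume v: "v \<in> class_verts c"
  show "(Apex c, v) \<in> ?E\<^sup>*"
  proof (cases v)
    case (Mid x y)
    then obtain z where z: "z = x \<or> z = y" "col z = c" "(x, y) \<in> A"
      using v by auto
    then have "(Apex c, Orig z) \<in> ?E\<^sup>*"
      using A_sub by (intro orig) auto
    moreover have "(Orig z, v) \<in> ?E"
      using z v Mid A_sub by auto
    ultimately show ?thesis
      by (rule rtrancl_into_rtrancl)
  qed (use v orig in auto)
qed

lemma connected_H: "c \<in> {1..k} \<Longrightarrow> connected (H c)"
  unfolding H_def using simple_class_verts rooted_class_verts by (rule connected_code_graph)

lemma edge_covers_H: "edge_covers (H ` {1..k}) G"
  unfolding edge_covers_def
proof (intro conjI ballI)
  fix K assume "K \<in> H ` {1..k}"
  then show "graph K" "subgraph K G"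
    using graph_H subgraph_code_graph[OF simple_V class_verts_subset] by (auto simp: G_def H_def)
next
  have cov: "\<exists>c\<in>{1..k}. u \<in> class_verts c \<and> v \<in> class_verts c" if "u \<in> V" "v \<in> V" "link col full u v" for u v
    using that A_sub col_range by (cases u; cases v) auto
  then have "\<exists>c\<in>{1..k}. u \<in> class_verts c \<and> v \<in> class_verts c" if "u \<in> V" "v \<in> V" "adj u v" for u v
    using that unfolding adj_def by blast
  then show "arcs G = (\<Union>K\<in>H ` {1..k}. arcs K)"
    using class_verts_subset by (fastforce simp: G_def H_def code_graph_def)
qed

text \<open>Adjacency in the base graph.\<close>

definition nbr :: "'b \<Rightarrow> 'b \<Rightarrow> bool" where
  "nbr x y \<longleftrightarrow> (x, y) \<in> A \<or> (y, x) \<in> A"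

lemma isometric_H_full:
  assumes "c \<in> {1..k}" "full"
  shows "isometric_subgraph (H c) G"
  unfolding H_def G_def
proof (rule isometric_code_graph[OF simple_V class_verts_subset[OF assms(1)] rooted_class_verts])
  let ?\<phi> = "\<lambda>v. if v \<in> class_verts c then v else Apex c"
  have univ: "v = Apex c \<or> adj v (Apex c)" if "v \<in> class_verts c" for v
    using that by (cases v) (auto simp: adj_Apex_Mid[OF assms(2)] simp del: adj_simps(4,5))
  then have "v = Apex c \<or> adj (Apex c) v" if "v \<in> class_verts c" for v
    using that adj_sym by metis
  with univ show "?\<phi> u = ?\<phi> v \<or> adj (?\<phi> u) (?\<phi> v)" if "u \<in> V" "v \<in> V" "adj u v" for u v
    using that by auto
qed auto

lemma isometric_H:
  assumes "c \<in> {1..k}" "\<not> full"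
    and uniq: "\<And>x y z. \<lbrakk>x \<in> X; col x \<noteq> c; nbr x y; nbr x z; col y = c; col z = c\<rbrakk> \<Longrightarrow> y = z"
  shows "isometric_subgraph (H c) G"
  unfolding H_def G_def
proof (rule isometric_code_graph[OF simple_V class_verts_subset[OF assms(1)] rooted_class_verts])
  \<comment> \<open>\<open>\<psi> x\<close> is the image of a base vertex \<open>x\<close> of another colour, \<open>\<phi>\<close> is the retraction.\<close>
  define \<psi> where "\<psi> x = (if \<exists>y. nbr x y \<and> col y = c
    then Orig (SOME y. nbr x y \<and> col y = c) else Apex c)" for x
  define \<phi> where "\<phi> v = (if v \<in> class_verts c then v else case v of Orig x \<Rightarrow> \<psi> x | _ \<Rightarrow> Apex c)" for v
  have nbr_X: "x \<in> X \<and> y \<in> X" if "nbr x y" for x y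
    using that A_sub by (auto simp: nbr_def)
  have \<psi>1: "\<psi> x = Orig y" if "x \<in> X" "col x \<noteq> c" "nbr x y" "col y = c" for x y
  proof -
    have "nbr x (SOME y. nbr x y \<and> col y = c) \<and> col (SOME y. nbr x y \<and> col y = c) = c"
      by (rule someI[of "\<lambda>y. nbr x y \<and> col y = c"]) (use that in simp)
    then show ?thesis
      using uniq[OF that(1,2)] that(3,4) by (auto simp: \<psi>_def)
  qed
  have \<psi>2: "\<psi> x = Apex c \<or> (\<exists>y. \<psi> x = Orig y \<and> y \<in> X \<and> col y = c)" if "x \<in> X" "col x \<noteq> c" for x
    using \<psi>1[OF that] nbr_X by (cases "\<exists>y. nbr x y \<and> col y = c") (auto simp: \<psi>_def[of x])
  show "\<phi> v = v" if "v \<in> class_verts c" for v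
    using that by (simp add: \<phi>_def)
  show "\<phi> v \<in> class_verts c" if v: "v \<in> V" for v
  proof (cases "v \<in> class_verts c")
    case False
    show ?thesis
    proof (cases v)
      case (Orig x)
      then show ?thesis
        using False v \<psi>2[of x] by (auto simp: \<phi>_def)
    qed (use False in \<open>auto simp: \<phi>_def\<close>)
  qed (simp add: \<phi>_def)
  have \<phi>_Orig: "\<phi> (Orig x) = Apex c \<or> adj (Apex c) (\<phi> (Orig x))" if "x \<in> X" for x
    using that \<psi>2[of x] by (cases "col x = c") (auto simp: \<phi>_def)
  have *: "\<phi> u = \<phi> v \<or> adj (\<phi> u) (\<phi> v)" if "u \<in> V" "v \<in> V" "link col full u v" for u v
    using that(3)
  proof (cases rule: linkE)
    case (orig d x)
    then have "\<phi> u = Apex c"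
      by (cases "d = c") (auto simp: \<phi>_def)
    then show ?thesis
      using \<phi>_Orig[of x] orig that by auto
  next
    case (inc z x y)
    then have z: "u = Orig z" "v = Mid x y" "z = x \<or> z = y" "(x, y) \<in> A"
      using that by auto
    show ?thesis
    proof (cases "v \<in> class_verts c")
      case False
      then have "\<phi> v = Apex c"
        using z by (simp add: \<phi>_def)
      moreover have "z \<in> X"
        using z A_sub by auto
      ultimately show ?thesis
        using \<phi>_Orig[of z] z(1) adj_sym by metis
    next
      case True
      then have v: "\<phi> v = Mid x y" "col x = c \<or> col y = c"
        using z by (auto simp: \<phi>_def)
      show ?thesis
      proof (cases "col z = c")
        case True
        then show ?thesis
          using z v A_sub by (auto simp: \<phi>_def)
      next
        case False
        then obtain z' where z': "z' = x \<or> z' = y" "col z' = c" "nbr z z'"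
          using v z by (auto simp: nbr_def)
        then have "\<phi> u = Orig z'"
          using \<psi>1[of z z'] False nbr_X z(1) by (auto simp: \<phi>_def)
        then show ?thesis
          using v(1) z'(1) by auto
      qed
    qed
  qed (use assms(2) in auto)
  show "\<phi> u = \<phi> v \<or> adj (\<phi> u) (\<phi> v)" if "u \<in> V" "v \<in> V" "adj u v" for u v
    using that *[of u v] *[of v u] adj_sym[of "\<phi> u"] unfolding adj_def[of u v] by metis
qed

lemma is_tree_H:
  assumes "c \<in> {1..k}" "\<not> full" "\<And>x y. (x, y) \<in> A \<Longrightarrow> \<not> (col x = c \<and> col y = c)"
  shows "is_tree (H c)"
  unfolding H_def
proof (rule is_tree_code_graph[OF simple_class_verts[OF assms(1)] rooted_class_verts,
    where f = "\<lambda>v. case v of Apex _ \<Rightarrow> 0 | Orig _ \<Rightarrow> 1 | Mid _ _ \<Rightarrow> 2"])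
  fix v u w
  assume *: "v \<in> class_verts c" "u \<in> class_verts c" "w \<in> class_verts c" "adj v u" "adj v w"
    "(case u of Apex _ \<Rightarrow> 0 | Orig _ \<Rightarrow> 1 | Mid _ _ \<Rightarrow> 2) \<le> (case v of Apex _ \<Rightarrow> 0 | Orig _ \<Rightarrow> 1 | Mid _ _ \<Rightarrow> (2::nat))"
    "(case w of Apex _ \<Rightarrow> 0 | Orig _ \<Rightarrow> 1 | Mid _ _ \<Rightarrow> 2) \<le> (case v of Apex _ \<Rightarrow> 0 | Orig _ \<Rightarrow> 1 | Mid _ _ \<Rightarrow> (2::nat))"
  then show "u = w"
    using assms(3) by (cases v; cases u; cases w) (auto simp: not_adj_Apex_Mid[OF assms(2)] simp del: adj_simps(4,5))
qed

text \<open>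
  Here the colour class induces a star forest in the base graph, and \<open>s\<close> maps every vertex of the
  class to the centre of its star (arcs point away from the centres).  If the class is independent,
  \<open>s\<close> is the identity and \<open>d = 3\<close> is possible.
\<close>

lemma treedepth_H_le:
  assumes c: "c \<in> {1..k}"
    and s: "\<And>x. \<lbrakk>x \<in> X; col x = c\<rbrakk> \<Longrightarrow> s x \<in> X \<and> col (s x) = c \<and> s (s x) = s x"
    and star: "\<And>x y. \<lbrakk>(x, y) \<in> A; col x = c; col y = c\<rbrakk> \<Longrightarrow> s x = x \<and> s y = x"
    and d: "3 \<le> d" "\<And>x. \<lbrakk>x \<in> X; col x = c; s x \<noteq> x\<rbrakk> \<Longrightarrow> 4 \<le> d"
  shows "treedepth (H c) \<le> d"
proof -
  \<comment> \<open>The label of a base vertex passes through the centre of its star; the label of a subdivision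
    vertex extends that of its end in the class, or of the leaf of the star if both ends are in it.\<close>
  define l where "l x = Apex c # (if s x = x then [Orig x] else [Orig (s x), Orig x])" for x
  define top where "top x y = (if col y = c then y else x)" for x y
  define L where "L v = (case v of Apex _ \<Rightarrow> [Apex c] | Orig x \<Rightarrow> l x | Mid x y \<Rightarrow> l (top x y) @ [Mid x y])" for v
  have last_L: "last (L v) = v" if "v \<in> class_verts c" for v
    using that by (cases v) (auto simp: L_def l_def)
  have top: "top x y \<in> X" "col (top x y) = c" if "Mid x y \<in> class_verts c" for x y
    using that A_sub by (auto simp: top_def)
  have *: "prefix (L u) (L v)" if "u \<in> class_verts c" "v \<in> class_verts c" "link col full u v" for u v
    using that(3)
  proof (cases rule: linkE)
    case (inc z x y)
    then have z: "u = Orig z" "v = Mid x y" "z = x \<or> z = y" "(x, y) \<in> A" "col z = c"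
      using that by auto
    show ?thesis
    proof (cases "z = top x y")
      case True
      then show ?thesis
        using z by (simp add: L_def)
    next
      case False
      then have "z = x" "top x y = y" "col y = c"
        using z by (auto simp: top_def split: if_splits)
      then have "s z = z" "s (top x y) = z"
        using star[of x y] z by auto
      then show ?thesis
        using False z by (auto simp: L_def l_def)
    qed
  qed (use that in \<open>auto simp: L_def l_def\<close>)
  have d4: "s z = z \<or> 4 \<le> d" if "z \<in> X" "col z = c" for z
    using d(2) that by blast
  show ?thesis
    unfolding H_def
  proof (rule treedepth_code_graph_le[OF simple_class_verts[OF c], where l = L])
    show "inj_on L (class_verts c)"
      using last_L by (metis inj_onI)
    show "prefix (L u) (L v) \<or> prefix (L v) (L u)" if "u \<in> class_verts c" "v \<in> class_verts c" "adj u v" for u v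
      using that * by (auto simp: adj_def)
    show "L v \<noteq> [] \<and> length (L v) \<le> d" if v: "v \<in> class_verts c" for v
    proof (cases v)
      case (Mid x y)
      then have "s (top x y) = top x y \<or> 4 \<le> d"
        using d4 top[of x y] v by blast
      then show ?thesis
        using Mid d(1) by (auto simp: L_def l_def)
    qed (use d(1) in \<open>auto simp: L_def l_def\<close>)
  qed
qed

lemma treedepth_H_gt_2:
  assumes "c \<in> {1..k}" "(x, y) \<in> A" "z = x \<or> z = y" "col z = c" "z' \<in> X" "col z' = c" "z' \<noteq> z"
  shows "2 < treedepth (H c)"
  unfolding H_def
  by (rule treedepth_code_graph_gt[OF simple_class_verts[OF assms(1)], of "[Mid x y, Orig z, Apex c, Orig z']"])
    (use assms A_sub in auto)

lemma treedepth_H_gt_3: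
  assumes "c \<in> {1..k}" "(x, y) \<in> A" "(w, x) \<in> A" "(w, x') \<in> A" "x \<noteq> x'" "w' \<in> X"
    "col x = c" "col w = c" "col x' = c" "col w' = c" "w' \<notin> {x, w, x'}"
  shows "3 < treedepth (H c)"
proof -
  have "w \<noteq> x" "w \<noteq> x'"
    using assms A_asym by blast+
  then show ?thesis
    unfolding H_def
    by (intro treedepth_code_graph_gt[OF simple_class_verts[OF assms(1)], of "[Mid x y, Orig x, Mid w x,
          Orig w, Mid w x', Orig x', Apex c, Orig w']"])
      (use assms A_sub in auto)
qed

lemma clique_minor_H_full:
  assumes "c \<in> {1..k}" "full" "(x, y) \<in> A" "col x = c"
  shows "\<exists>B. clique_minor (H c) (Suc 2) B"
  unfolding H_def
  by (rule clique_minor_triangleI[OF simple_class_verts[OF assms(1)], of "{Apex c}" "{Orig x}" "{Mid x y}"])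
    (use assms(1,3,4) A_sub in \<open>auto simp: rooted_singleton adj_Apex_Mid[OF assms(2)]
      simp del: adj_simps(4,5)\<close>)

lemma clique_minor_H:
  assumes "c \<in> {1..k}" "(x, y) \<in> A" "col x = c" "col y = c"
  shows "\<exists>B. clique_minor (H c) (Suc 2) B"
  unfolding H_def
proof (rule clique_minor_triangleI[OF simple_class_verts[OF assms(1)], of "{Apex c}" "{Orig x}" "{Orig y, Mid x y}"])
  show "rooted adj {Orig y, Mid x y}"
    unfolding rooted_def by (intro bexI[of _ "Orig y"]) (auto intro!: r_into_rtrancl)
  show "{Orig x} \<inter> {Orig y, Mid x y} = {}"
    using assms(2) A_asym by auto
qed (use assms A_sub in \<open>auto simp: rooted_singleton\<close>)

text \<open>
  Here the colour class induces a linear forest in the base graph: \<open>b\<close> numbers its vertices such that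
  adjacent ones have consecutive numbers.  The vertex number \<open>q\<close> gets the block
  \<open>q K, \<dots>, q K + K - 1\<close> as its interval.  A subdivision vertex between the blocks \<open>q\<close> and \<open>q + 1\<close>
  gets the last point of the former and the first point of the latter; a subdivision vertex with one
  end in the class gets a single inner point of the block, determined by its code.  Thus every
  point lies in the intervals of at most one base vertex and of at most one subdivision vertex, and
  of the apex.
\<close>

lemma pathwidth_H:
  assumes c: "c \<in> {1..k}"
    and inj: "inj_on b {x \<in> X. col x = c}"
    and cons: "\<And>x y. \<lbrakk>(x, y) \<in> A; col x = c; col y = c\<rbrakk> \<Longrightarrow> b y = Suc (b x) \<or> b x = Suc (b y)"
    and minor: "\<exists>B. clique_minor (H c) (Suc 2) B"
  shows "pathwidth (H c) = 2"
proof -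
  have fin: "finite (class_verts c)"
    using simple_class_verts[OF c] by (simp add: simple_on_def)
  \<comment> \<open>Codes are shifted by one, so the first and the last point of a block stay free.\<close>
  define K where "K = Suc (Suc (Suc (Max (to_nat ` class_verts c))))"
  have code: "to_nat v + 3 \<le> K" if "v \<in> class_verts c" for v
    using that fin by (simp add: K_def)
  define M where "M = Max (b ` X)"
  have bM: "b x \<le> M" if "x \<in> X" for x
    using that finite_X by (simp add: M_def)
  have K: "0 < K" by (simp add: K_def)
  define both where "both x y \<longleftrightarrow> col x = c \<and> col y = c" for x y
  define top where "top x y = (if col y = c then y else x)" for x y
  define lo where "lo v = (case v of Apex _ \<Rightarrow> 0 | Orig x \<Rightarrow> b x * K
    | Mid x y \<Rightarrow> if both x y then min (b x) (b y) * K + (K - 1)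
        else b (top x y) * K + Suc (to_nat v))" for v :: "'b vert"
  define hi where "hi v = (case v of Apex _ \<Rightarrow> Suc M * K | Orig x \<Rightarrow> b x * K + (K - 1)
    | Mid x y \<Rightarrow> if both x y then Suc (min (b x) (b y)) * K
        else b (top x y) * K + Suc (to_nat v))" for v :: "'b vert"
  have top: "top x y \<in> X" "col (top x y) = c" if "Mid x y \<in> class_verts c" for x y
    using that A_sub by (auto simp: top_def)
  have bound: "lo v \<le> hi v \<and> hi v \<le> Suc M * K" if v: "v \<in> class_verts c" for v
  proof (cases v)
    case (Apex d)
    then show ?thesis by (simp add: lo_def hi_def)
  next
    case (Orig x)
    then have "b x * K \<le> M * K"
      using v bM by simp
    then have "b x * K + (K - 1) \<le> Suc M * K"
      unfolding mult_Suc using K by linarith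
    then show ?thesis
      unfolding lo_def hi_def Orig vert.case by (intro conjI) simp_all
  next
    case (Mid x y)
    then have b: "b (top x y) \<le> M" "min (b x) (b y) \<le> M"
      using v bM top[of x y] A_sub by (auto simp: min_def)
    have "Suc (min (b x) (b y)) * K \<le> Suc M * K"
      using b(2) by (intro mult_le_mono1) simp
    moreover have "min (b x) (b y) * K + (K - 1) \<le> Suc (min (b x) (b y)) * K"
      by simp
    moreover have "b (top x y) * K \<le> M * K"
      using b(1) by simp
    then have "b (top x y) * K + Suc (to_nat v) \<le> Suc M * K"
      unfolding mult_Suc using code[OF v] by linarith
    ultimately show ?thesis
      unfolding lo_def hi_def using Mid
      by (cases "both x y") (simp_all del: mult_Suc)
  qed
  have meet: "lo u \<le> hi v \<and> lo v \<le> hi u" if uv: "u \<in> class_verts c" "v \<in> class_verts c" "link col full u v" for u v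
    using uv(3)
  proof (cases rule: linkE)
    case (inc z x y)
    then have z: "u = Orig z" "v = Mid x y" "z = x \<or> z = y" "(x, y) \<in> A" "col z = c"
      using uv by auto
    show ?thesis
    proof (cases "both x y")
      case True
      then have "b y = Suc (b x) \<or> b x = Suc (b y)"
        using cons z(4) by (simp add: both_def)
      then show ?thesis
        using z True by (auto simp: lo_def hi_def)
    next
      case False
      then have "top x y = z"
        using z by (auto simp: top_def both_def)
      then show ?thesis
        using z False code[OF uv(2)] by (auto simp: lo_def hi_def)
    qed
  next
    case (orig d x)
    then show ?thesis
      using bound[OF uv(2)] by (simp add: lo_def[of "Apex d"] hi_def[of "Apex d"])
  next
    case (mid d x y)
    then show ?thesis
      using bound[OF uv(2)] by (simp add: lo_def[of "Apex d"] hi_def[of "Apex d"])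
  qed
  have bag: "card {v \<in> class_verts c. lo v \<le> t \<and> t \<le> hi v} \<le> Suc 2" for t
  proof -
    let ?q = "t div K" and ?p = "t mod K"
    let ?S = "{v \<in> class_verts c. lo v \<le> t \<and> t \<le> hi v}"
    have t: "t = ?q * K + ?p" "?p < K"
      using K by simp_all
    have orig: "b x = ?q" if "Orig x \<in> ?S" for x
    proof -
      have "b x * K \<le> t" "t < b x * K + K"
        using that K by (auto simp: lo_def hi_def)
      then show ?thesis
        by (intro div_nat_eqI[symmetric]) (simp_all add: mult.commute)
    qed
    have joint: "?q = min (b x) (b y) \<and> ?p = K - 1 \<or> ?q = Suc (min (b x) (b y)) \<and> ?p = 0"
      if "Mid x y \<in> ?S" "both x y" for x y
    proof -
      let ?m = "min (b x) (b y)"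
      have "?m * K + (K - 1) \<le> t" "t \<le> Suc ?m * K"
        using that by (auto simp: lo_def hi_def)
      then have "t = ?m * K + (K - 1) \<or> t = Suc ?m * K"
        using K by (auto simp del: mult_le_mono)
      moreover have "(K - 1) div K = 0" "(K - 1) mod K = K - 1"
        using K by simp_all
      then have "(?m * K + (K - 1)) div K = ?m" "(?m * K + (K - 1)) mod K = K - 1"
        using K by (simp_all only: div_mult_self3 mod_mult_self3 add_0_right)
      moreover have "Suc ?m * K div K = Suc ?m" "Suc ?m * K mod K = 0"
        using K by (simp_all del: mult_Suc)
      ultimately show ?thesis by metis
    qed
    have pendant: "?p = Suc (to_nat (Mid x y)) \<and> Suc ?p < K"
      if "Mid x y \<in> ?S" "\<not> both x y" for x y
    proof -
      have "Suc (Suc (to_nat (Mid x y))) < K"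
        using code[of "Mid x y"] that(1) by simp
      moreover have "t = b (top x y) * K + Suc (to_nat (Mid x y))"
        using that by (auto simp: lo_def hi_def)
      ultimately show ?thesis by simp
    qed
    have mid: "Mid x y = Mid x' y'" if "Mid x y \<in> ?S" "Mid x' y' \<in> ?S" for x y x' y'
    proof (cases "both x y"; cases "both x' y'")
      assume *: "both x y" "both x' y'"
      have A: "(x, y) \<in> A" "(x', y') \<in> A"
        using that by auto
      have cls: "x \<in> {x \<in> X. col x = c}" "y \<in> {x \<in> X. col x = c}"
        "x' \<in> {x \<in> X. col x = c}" "y' \<in> {x \<in> X. col x = c}"
        using * A A_sub by (auto simp: both_def)
      have "3 \<le> K" by (simp add: K_def)
      then have "min (b x) (b y) = min (b x') (b y')"
        using joint[OF that(1) *(1)] joint[OF that(2) *(2)] by auto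
      moreover have "b y = Suc (b x) \<or> b x = Suc (b y)" "b y' = Suc (b x') \<or> b x' = Suc (b y')"
        using cons A * by (auto simp: both_def)
      ultimately have "b x = b x' \<and> b y = b y' \<or> b x = b y' \<and> b y = b x'"
        by auto
      then have "x = x' \<and> y = y' \<or> x = y' \<and> y = x'"
        using inj_on_eq_iff[OF inj cls(1,3)] inj_on_eq_iff[OF inj cls(2,4)]
          inj_on_eq_iff[OF inj cls(1,4)] inj_on_eq_iff[OF inj cls(2,3)] by blast
      then show ?thesis
        using A A_asym by auto
    qed (use joint[of x y] joint[of x' y'] pendant[of x y] pendant[of x' y'] that in auto)
    let ?O = "?S \<inter> range Orig" and ?M = "?S \<inter> {Mid x y |x y. True}"
    have "card ?O \<le> Suc 0"
    proof -
      have "u = v" if uv: "u \<in> ?O" "v \<in> ?O" for u v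
      proof -
        obtain x x' where x: "u = Orig x" "v = Orig x'" "Orig x \<in> ?S" "Orig x' \<in> ?S"
          using uv by auto
        then have "b x = b x'"
          using orig by metis
        then have "x = x'"
          by (rule inj_onD[OF inj]) (use x in auto)
        with x show ?thesis by simp
      qed
      then show ?thesis
        by (rule card_le_Suc_0I)
    qed
    moreover have "card ?M \<le> Suc 0"
    proof -
      have "u = v" if "u \<in> ?M" "v \<in> ?M" for u v
        using that mid by blast
      then show ?thesis
        by (rule card_le_Suc_0I)
    qed
    moreover have "?S \<subseteq> {Apex c} \<union> ?O \<union> ?M"
    proof
      show "v \<in> {Apex c} \<union> ?O \<union> ?M" if "v \<in> ?S" for v
        using that by (cases v) auto
    qed
    then have "card ?S \<le> card ({Apex c} \<union> ?O \<union> ?M)"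
      using fin by (intro card_mono) auto
    moreover have "card ({Apex c} \<union> ?O \<union> ?M) \<le> card ({Apex c} \<union> ?O) + card ?M"
      by (rule card_Un_le)
    moreover have "card ({Apex c} \<union> ?O) \<le> Suc 0 + card ?O"
      using card_Un_le[of "{Apex c}" ?O] by simp
    ultimately show ?thesis by linarith
  qed
  obtain B where B: "clique_minor (code_graph adj (class_verts c)) (Suc 2) B"
    using minor by (auto simp: H_def)
  show ?thesis
    unfolding H_def
    using pathwidth_code_graph_eq[OF simple_class_verts[OF c] bound _ bag B] meet
    by (auto simp: adj_def)
qed

end

section \<open>Tracks and links\<close>

text \<open>
  \<open>Track True i p\<close> is the vertex at position \<open>p\<close> of row \<open>i\<close>, \<open>Track False j p\<close> the vertex at
  position \<open>p\<close> of column \<open>j\<close>, and \<open>Link i j\<close> the vertex that links row \<open>i\<close> and column \<open>j\<close>.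
\<close>

datatype base = Track bool nat nat | Link nat nat

instance base :: countable
  by countable_datatype

text \<open>
  There are \<open>m\<close> rows and \<open>m\<close> columns with \<open>6 m\<close> positions each.  Links are attached at positions
  divisible by 6, since the positions on a track are coloured with period 2 or 3.
\<close>

definition base_verts :: "nat \<Rightarrow> base set" where
  "base_verts m = {Track b i p |b i p. i < m \<and> p < 6 * m} \<union> {Link i j |i j. i < m \<and> j < m}"

definition base_arcs :: "nat \<Rightarrow> (base \<times> base) set" where
  "base_arcs m = {(Track b i p, Track b i (Suc p)) |b i p. i < m \<and> Suc p < 6 * m} \<union>
     {(Link i j, Track True i (6 * j)) |i j. i < m \<and> j < m} \<union>
     {(Link i j, Track False j (6 * i)) |i j. i < m \<and> j < m}"

lemma in_base_verts [simp]:
  "Track b i p \<in> base_verts m \<longleftrightarrow> i < m \<and> p < 6 * m"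
  "Link i j \<in> base_verts m \<longleftrightarrow> i < m \<and> j < m"
  by (auto simp: base_verts_def)

lemma in_base_arcs [simp]:
  "(Track b i p, y) \<in> base_arcs m \<longleftrightarrow> y = Track b i (Suc p) \<and> i < m \<and> Suc p < 6 * m"
  "(Link i j, y) \<in> base_arcs m \<longleftrightarrow>
     i < m \<and> j < m \<and> (y = Track True i (6 * j) \<or> y = Track False j (6 * i))"
  by (auto simp: base_arcs_def)

lemma in_base_arcsE:
  assumes "(x, y) \<in> base_arcs m"
  obtains (track) b i p where "x = Track b i p" "y = Track b i (Suc p)" "i < m" "Suc p < 6 * m"
    | (row) i j where "x = Link i j" "y = Track True i (6 * j)" "i < m" "j < m"
    | (column) i j where "x = Link i j" "y = Track False j (6 * i)" "i < m" "j < m"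
  using assms by (cases x) auto

lemma finite_base_verts: "finite (base_verts m)"
proof -
  have "base_verts m = (\<Union>b. \<Union>i\<in>{..<m}. Track b i ` {..<6 * m}) \<union> (\<Union>i\<in>{..<m}. Link i ` {..<m})"
    by (auto simp: base_verts_def)
  then show ?thesis by simp
qed

text \<open>
  The construction for the base graph of tracks and links.  The colouring is defined on the whole
  type; its values outside the base graph only have to be in the range.
\<close>

locale link_grid =
  fixes m :: nat and col :: "base \<Rightarrow> nat" and full :: bool and k :: nat
  assumes m: "2 \<le> m" and col: "\<And>x. col x \<in> {1..k}"
begin

sublocale coloured_digraph "base_verts m" "base_arcs m" col full k
proof
  show "finite (base_verts m)" by (rule finite_base_verts)
  show "x \<in> base_verts m \<and> y \<in> base_verts m" if "(x, y) \<in> base_arcs m" for x y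
    using that by (cases rule: in_base_arcsE) auto
  show "(y, x) \<notin> base_arcs m" if "(x, y) \<in> base_arcs m" for x y
    using that by (cases rule: in_base_arcsE) auto
  show "col x \<in> {1..k}" for x by (rule col)
qed

lemma nbr_TrackD:
  assumes "nbr (Track b i p) y"
  obtains "y = Track b i (Suc p)" | q where "p = Suc q" "y = Track b i q"
    | "6 dvd p" "y = (if b then Link i (p div 6) else Link (p div 6) i)"
  using assms by (cases y) (auto simp: nbr_def)

lemma nbr_LinkD:
  assumes "nbr (Link i j) y"
  obtains "y = Track True i (6 * j)" | "y = Track False j (6 * i)"
  using assms by (cases y) (auto simp: nbr_def)

text \<open>
  The \<open>i\<close>-th branch set consists of row \<open>i\<close>, column \<open>i\<close>, the links \<open>Link i j\<close> for all \<open>j\<close>, and the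
  subdivision vertices of the arcs that end in it.
\<close>

fun idx :: "base \<Rightarrow> nat" where
  "idx (Track b i p) = i"
| "idx (Link i j) = i"

fun owner :: "base vert \<Rightarrow> nat option" where
  "owner (Apex c) = None"
| "owner (Orig x) = Some (idx x)"
| "owner (Mid x y) = Some (idx y)"

definition branch :: "nat \<Rightarrow> base vert set" where
  "branch i = {v \<in> V. owner v = Some i}"

lemma in_branch [simp]:
  "Apex c \<notin> branch i"
  "Orig x \<in> branch i \<longleftrightarrow> x \<in> base_verts m \<and> idx x = i"
  "Mid x y \<in> branch i \<longleftrightarrow> (x, y) \<in> base_arcs m \<and> idx y = i"
  by (auto simp: branch_def)

lemma rooted_branch:
  assumes i: "i < m"
  shows "rooted adj (branch i)"
proof -
  let ?E = "{(u, v). u \<in> branch i \<and> v \<in> branch i \<and> adj u v}"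
  let ?r = "Orig (Track True i 0)"
  have sym: "sym (?E\<^sup>*)"
    using adj_sym by (intro sym_rtrancl symI) auto
  have edge: "(Orig x, Mid x y) \<in> ?E \<and> (Mid x y, Orig y) \<in> ?E"
    if "(x, y) \<in> base_arcs m" "idx x = i" "idx y = i" for x y
    using that A_sub by auto
  have two: "(Orig x, Orig y) \<in> ?E\<^sup>*" "(Orig y, Orig x) \<in> ?E\<^sup>*"
    if "(x, y) \<in> base_arcs m" "idx x = i" "idx y = i" for x y
  proof -
    show "(Orig x, Orig y) \<in> ?E\<^sup>*"
      using edge[OF that] by (meson converse_rtrancl_into_rtrancl r_into_rtrancl)
    with sym show "(Orig y, Orig x) \<in> ?E\<^sup>*"
      by (rule symD)
  qed
  have track: "(Orig (Track b i 0), Orig (Track b i p)) \<in> ?E\<^sup>*" if "p < 6 * m" for b p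
    using that
  proof (induction p)
    case (Suc p)
    then have "(Orig (Track b i 0), Orig (Track b i p)) \<in> ?E\<^sup>*" by simp
    also have "(Orig (Track b i p), Orig (Track b i (Suc p))) \<in> ?E\<^sup>*"
      using Suc.prems i by (intro two) auto
    finally show ?case .
  qed simp
  have link: "(?r, Orig (Link i j)) \<in> ?E\<^sup>*" if "j < m" for j
  proof -
    have "(?r, Orig (Track True i (6 * j))) \<in> ?E\<^sup>*"
      using that by (intro track) simp
    also have "(Orig (Track True i (6 * j)), Orig (Link i j)) \<in> ?E\<^sup>*"
      using that i by (intro two) auto
    finally show ?thesis .
  qed
  have "(?r, Orig (Link i i)) \<in> ?E\<^sup>*"
    using i by (rule link)
  also have "(Orig (Link i i), Orig (Track False i (6 * i))) \<in> ?E\<^sup>*"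
    using i by (intro two) auto
  also have "(Orig (Track False i (6 * i)), Orig (Track False i 0)) \<in> ?E\<^sup>*"
    using sym track[of "6 * i" False] i by (meson symD mult_less_cancel1 zero_less_numeral)
  finally have column: "(?r, Orig (Track False i 0)) \<in> ?E\<^sup>*" .
  have orig: "(?r, Orig x) \<in> ?E\<^sup>*" if x: "x \<in> base_verts m" "idx x = i" for x
  proof (cases x)
    case (Track b i' p)
    then have "(Orig (Track b i 0), Orig x) \<in> ?E\<^sup>*"
      using x by (auto intro: track)
    then show ?thesis
      using column by (cases b) (auto intro: rtrancl_trans)
  next
    case (Link i' j)
    then show ?thesis
      using x link by auto
  qed
  have "(?r, v) \<in> ?E\<^sup>*" if v: "v \<in> branch i" for v
  proof (cases v)
    case (Mid x y)
    then have xy: "(x, y) \<in> base_arcs m" "idx y = i"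
      using v by auto
    then have "(?r, Orig y) \<in> ?E\<^sup>*"
      using A_sub by (intro orig) auto
    moreover have "(Orig y, v) \<in> ?E"
      using xy Mid A_sub by auto
    ultimately show ?thesis
      by (rule rtrancl_into_rtrancl)
  qed (use v orig in auto)
  moreover have "?r \<in> branch i"
    using i by simp
  ultimately show ?thesis
    unfolding rooted_def by blast
qed

lemma treewidth_G: "int (m - 1) \<le> treewidth G"
proof (rule treewidth_ge[OF graph_G])
  have "clique_minor (code_graph adj V) m (\<lambda>i. to_nat ` branch i)"
  proof (rule clique_minor_code_graph[OF simple_V])
    show "branch i \<subseteq> V \<and> rooted adj (branch i)" if "i < m" for i
      using rooted_branch[OF that] by (auto simp: branch_def)
    show "branch i \<inter> branch j = {} \<and> (\<exists>u\<in>branch i. \<exists>v\<in>branch j. adj u v)"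
      if "i < m" "j < m" "i \<noteq> j" for i j
    proof
      show "branch i \<inter> branch j = {}"
        using that by (auto simp: branch_def)
      have "Orig (Link i j) \<in> branch i" "Mid (Link i j) (Track False j (6 * i)) \<in> branch j"
        "adj (Orig (Link i j)) (Mid (Link i j) (Track False j (6 * i)))"
        using that by simp_all
      then show "\<exists>u\<in>branch i. \<exists>v\<in>branch j. adj u v" by blast
    qed
  qed
  then show "clique_minor G (Suc (m - 1)) (\<lambda>i. to_nat ` branch i)"
    using m by (simp add: G_def)
qed

lemma treedepth_independent:
  assumes "c \<in> {1..k}" "\<And>x y. (x, y) \<in> base_arcs m \<Longrightarrow> \<not> (col x = c \<and> col y = c)"
    and "(x, y) \<in> base_arcs m" "z = x \<or> z = y" "col z = c" "z' \<in> base_verts m" "col z' = c" "z' \<noteq> z"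
  shows "treedepth (H c) = 3"
proof -
  have "treedepth (H c) \<le> 3"
    by (rule treedepth_H_le[OF assms(1), of "\<lambda>x. x"]) (use assms(2) in auto)
  then show ?thesis
    using treedepth_H_gt_2[OF assms(1,3-8)] by simp
qed

lemma pathwidth_independent:
  assumes "c \<in> {1..k}" "full" "\<And>x y. (x, y) \<in> base_arcs m \<Longrightarrow> \<not> (col x = c \<and> col y = c)"
    and "(x, y) \<in> base_arcs m" "col x = c"
  shows "pathwidth (H c) = 2"
  by (rule pathwidth_H[OF assms(1), of to_nat])
    (use assms(3) clique_minor_H_full[OF assms(1,2,4,5)] in auto)

text \<open>
  The next two functions describe the components of a class that consists of all links and of the
  positions divisible by 2 (or 3): each link is the centre of a path with three vertices, the
  other vertices are isolated.  The offset orders the path as row vertex, link, column vertex.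
\<close>

fun centre :: "base \<Rightarrow> base" where
  "centre (Track True i p) = (if 6 dvd p then Link i (p div 6) else Track True i p)"
| "centre (Track False j p) = (if 6 dvd p then Link (p div 6) j else Track False j p)"
| "centre (Link i j) = Link i j"

fun offset :: "base \<Rightarrow> nat" where
  "offset (Track b j p) = (if 6 dvd p \<and> \<not> b then 2 else 0)"
| "offset (Link i j) = 1"

lemma treedepth_pathwidth_link_class:
  assumes c: "c \<in> {1..k}" and d: "1 < d" "d dvd 6"
    and Link: "\<And>i j. col (Link i j) = c"
    and Track: "\<And>b i p. col (Track b i p) = c \<longleftrightarrow> d dvd p"
  shows "treedepth (H c) = 4" "pathwidth (H c) = 2"
proof -
  have no_track: "\<not> (d dvd p \<and> d dvd Suc p)" for p
    using d(1) by (metis One_nat_def dvd_1_iff_1 dvd_add_right_iff less_irrefl plus_1_eq_Suc add.commute)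
  have six: "d dvd p" if "6 dvd p" for p
    using that d(2) by (rule dvd_trans[rotated])
  have "treedepth (H c) \<le> 4"
  proof (rule treedepth_H_le[OF c, where s = centre])
    show "centre x \<in> base_verts m \<and> col (centre x) = c \<and> centre (centre x) = centre x"
      if "x \<in> base_verts m" "col x = c" for x
      using that by (cases x rule: centre.cases) (auto simp: Link)
    show "centre x = x \<and> centre y = x"
      if "(x, y) \<in> base_arcs m" "col x = c" "col y = c" for x y
      using that by (cases rule: in_base_arcsE) (use no_track in \<open>auto simp: Track\<close>)
  qed auto
  moreover have "3 < treedepth (H c)"
    by (rule treedepth_H_gt_3[OF c, of "Track True 0 0" "Track True 0 1" "Link 0 0"
          "Track False 0 0" "Link 0 1"]) (use m in \<open>auto simp: Link Track\<close>)
  ultimately show "treedepth (H c) = 4" by simp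
  show "pathwidth (H c) = 2"
  proof (rule pathwidth_H[OF c, where b = "\<lambda>x. 3 * to_nat (centre x) + offset x"])
    show "inj_on (\<lambda>x. 3 * to_nat (centre x) + offset x) {x \<in> base_verts m. col x = c}"
    proof (rule inj_onI)
      fix x y assume eq: "3 * to_nat (centre x) + offset x = 3 * to_nat (centre y) + offset y"
      have "offset z < 3" for z
        by (cases z) auto
      from this[of x] this[of y] have "offset x = offset y \<and> to_nat (centre x) = to_nat (centre y)"
        using eq by presburger
      then have "offset x = offset y" "centre x = centre y"
        by simp_all
      then show "x = y"
        by (cases x rule: centre.cases; cases y rule: centre.cases)
          (auto split: if_splits elim!: dvdE)
    qed
    show "3 * to_nat (centre y) + offset y = Suc (3 * to_nat (centre x) + offset x) \<or>
        3 * to_nat (centre x) + offset x = Suc (3 * to_nat (centre y) + offset y)"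
      if "(x, y) \<in> base_arcs m" "col x = c" "col y = c" for x y
      using that by (cases rule: in_base_arcsE) (use no_track in \<open>auto simp: Track\<close>)
    show "\<exists>B. clique_minor (H c) (Suc 2) B"
      by (rule clique_minor_H[OF c, of "Link 0 0" "Track True 0 0"])
        (use m in \<open>auto simp: Link Track\<close>)
  qed
qed

end

section \<open>The colourings for four, three and two subgraphs\<close>

text \<open>
  In the first colouring the rows are shifted by one against the columns.  The second one gives 3
  to the positions divisible by 3 and the remainder modulo 3 to the others.
\<close>

fun colour4 :: "base \<Rightarrow> nat" where
  "colour4 (Track b i p) = Suc ((p + of_bool b) mod 3)"
| "colour4 (Link i j) = 4"

fun colour3 :: "base \<Rightarrow> nat" where
  "colour3 (Track b i p) = Suc ((p + 2) mod 3)"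
| "colour3 (Link i j) = 3"

fun colour2 :: "base \<Rightarrow> nat" where
  "colour2 (Track b i p) = (if odd p then 1 else 2)"
| "colour2 (Link i j) = 2"

lemma mod_3_neighbours:
  fixes q a :: nat
  shows "(Suc (Suc q) + a) mod 3 \<noteq> (q + a) mod 3"
  by presburger

theorem theorem1:
  fixes n k :: nat
  assumes "n \<ge> 1" and "k \<in> {2, 3, 4}"
  shows "\<exists>H :: nat \<Rightarrow> (nat, nat \<times> nat) pre_digraph.
    (\<forall>i\<in>{1..k}. graph (H i) \<and> connected (H i)) \<and>
    (k = 4 \<longrightarrow> (\<forall>i\<in>{1, 2, 3, 4}. is_tree (H i) \<and> treedepth (H i) = 3)) \<and>
    (k = 3 \<longrightarrow> is_tree (H 1) \<and> is_tree (H 2) \<and> treedepth (H 1) = 3 \<and> treedepth (H 2) = 3 \<and>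
       pathwidth (H 3) = 2 \<and> treedepth (H 3) = 4) \<and>
    (k = 2 \<longrightarrow> pathwidth (H 1) = 2 \<and> pathwidth (H 2) = 2 \<and>
       treedepth (H 1) = 3 \<and> treedepth (H 2) = 4) \<and>
    (\<exists>G :: (nat, nat \<times> nat) pre_digraph.
       graph G \<and> treewidth G \<ge> int n \<and>
       (\<forall>i\<in>{1..k}. isometric_subgraph (H i) G) \<and>
       edge_covers (H ` {1..k}) G)"
proof -
  consider "k = 4" | "k = 3" | "k = 2"
    using assms(2) by auto
  then show ?thesis
  proof cases
    case 1
    interpret L: link_grid "Suc n" colour4 False 4
    proof
      show "colour4 x \<in> {1..4}" for x by (cases x) auto
    qed (use assms(1) in simp)
    have indep: "\<not> (colour4 x = c \<and> colour4 y = c)" if "(x, y) \<in> base_arcs (Suc n)" for x y c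
      using that by (cases rule: in_base_arcsE) (auto simp: mod_Suc)
    have "is_tree (L.H c) \<and> treedepth (L.H c) = 3" if c: "c \<in> {1..4}" for c
    proof
      show "is_tree (L.H c)"
        using c indep by (intro L.is_tree_H) auto
      show "treedepth (L.H c) = 3"
      proof (cases "c = 4")
        case True
        show ?thesis
          by (rule L.treedepth_independent[OF c, of "Link 0 0" "Track True 0 0" "Link 0 0" "Link 0 1"])
            (use indep True assms(1) in auto)
      next
        case False
        show ?thesis
          by (rule L.treedepth_independent[OF c, of "Track False 0 (c - 1)" "Track False 0 c"
                "Track False 0 (c - 1)" "Track False 1 (c - 1)"])
            (use indep False c assms(1) in auto)
      qed
    qed
    moreover have "isometric_subgraph (L.H c) L.G" if c: "c \<in> {1..4}" for c
    proof (rule L.isometric_H[OF c])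
      show "y = z" if yz: "L.nbr x y" "L.nbr x z" "colour4 y = c" "colour4 z = c" for x y z
      proof (cases x)
        case (Track b i p)
        have link: "colour4 (Track b' i' p') \<noteq> 4" for b' i' p'
          by simp
        have two: "colour4 (Track b i (Suc (Suc q))) \<noteq> colour4 (Track b i q)" for q
          using mod_3_neighbours by simp
        show ?thesis
          using yz(1)[unfolded Track] yz(2)[unfolded Track]
          by (elim L.nbr_TrackD) (use yz(3,4) link two two[symmetric] in
              \<open>auto simp del: colour4.simps(1) split: if_splits\<close>)
      next
        case (Link i j)
        have "colour4 (Track True i' (6 * l)) = 2" "colour4 (Track False i' (6 * l)) = 1" for i' l
          unfolding colour4.simps of_bool_eq by presburger+
        then show ?thesis
          using yz(1)[unfolded Link] yz(2)[unfolded Link]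
          by (elim L.nbr_LinkD) (use yz(3,4) in \<open>auto simp del: colour4.simps(1)\<close>)
      qed
    qed simp
    ultimately show ?thesis
      using 1 L.graph_H L.connected_H L.graph_G L.treewidth_G L.edge_covers_H
      by (intro exI[of _ L.H] conjI exI[of _ L.G]) auto
  next
    case 2
    interpret L: link_grid "Suc n" colour3 False 3
    proof
      show "colour3 x \<in> {1..3}" for x
        by (cases x) auto
    qed (use assms(1) in simp)
    have indep: "\<not> (colour3 x = c \<and> colour3 y = c)"
      if "(x, y) \<in> base_arcs (Suc n)" "c \<in> {1, 2}" for x y c
      using that by (cases rule: in_base_arcsE) (auto simp: mod_Suc)
    have tree: "is_tree (L.H c) \<and> treedepth (L.H c) = 3" if c: "c \<in> {1, 2}" for c
    proof
      have c': "c \<in> {1..3}"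
        using c by auto
      show "is_tree (L.H c)"
        using c c' indep by (intro L.is_tree_H) auto
      show "treedepth (L.H c) = 3"
        by (rule L.treedepth_independent[OF c', of "Track False 0 c" "Track False 0 (Suc c)"
              "Track False 0 c" "Track False 1 c"])
          (use indep c assms(1) in auto)
    qed
    have "colour3 (Track b i p) = 3 \<longleftrightarrow> 3 dvd p" for b i p
      unfolding colour3.simps by presburger
    then have big: "treedepth (L.H 3) = 4" "pathwidth (L.H 3) = 2"
      by (auto intro!: L.treedepth_pathwidth_link_class[of 3 3] simp del: colour3.simps(1))
    have "isometric_subgraph (L.H c) L.G" if c: "c \<in> {1..3}" for c
    proof (rule L.isometric_H[OF c])
      show "y = z"
        if yz: "colour3 x \<noteq> c" "L.nbr x y" "L.nbr x z" "colour3 y = c" "colour3 z = c" for x y z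
      proof (cases x)
        case (Track b i p)
        have two: "colour3 (Track b i (Suc (Suc q))) \<noteq> colour3 (Track b i q)" for q
          using mod_3_neighbours[of q 2] by simp
        have link: "colour3 (Track b i p) = 3" if "6 dvd p"
          using that unfolding colour3.simps by presburger
        show ?thesis
          using yz(2)[unfolded Track] yz(3)[unfolded Track]
          by (elim L.nbr_TrackD)
            (use yz(1,4,5) Track link two two[symmetric] in
              \<open>auto simp del: colour3.simps(1) split: if_splits\<close>)
      next
        case (Link i j)
        have "colour3 (Track b l (6 * p)) = 3" for b l p
          unfolding colour3.simps by presburger
        then show ?thesis
          using yz(2)[unfolded Link] yz(1,4) Link by (elim L.nbr_LinkD) auto
      qed
    qed simp
    then show ?thesis
      using 2 tree big L.graph_H L.connected_H L.graph_G L.treewidth_G L.edge_covers_H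
      by (intro exI[of _ L.H] conjI exI[of _ L.G]) auto
  next
    case 3
    interpret L: link_grid "Suc n" colour2 True 2
    proof
      show "colour2 x \<in> {1..2}" for x by (cases x) auto
    qed (use assms(1) in simp)
    have indep: "\<not> (colour2 x = 1 \<and> colour2 y = 1)" if "(x, y) \<in> base_arcs (Suc n)" for x y
      using that by (cases rule: in_base_arcsE) auto
    have "treedepth (L.H 1) = 3"
      by (rule L.treedepth_independent[of 1 "Track False 0 1" "Track False 0 2"
            "Track False 0 1" "Track False 1 1"])
        (use indep assms(1) in auto)
    moreover have "pathwidth (L.H 1) = 2"
      by (rule L.pathwidth_independent[of 1 "Track False 0 1" "Track False 0 2"])
        (use indep assms(1) in auto)
    moreover have "treedepth (L.H 2) = 4" "pathwidth (L.H 2) = 2"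
      by (rule L.treedepth_pathwidth_link_class[of 2 2]; auto)+
    moreover have "isometric_subgraph (L.H c) L.G" if "c \<in> {1..2}" for c
      using that by (rule L.isometric_H_full) simp
    ultimately show ?thesis
      using 3 L.graph_H L.connected_H L.graph_G L.treewidth_G L.edge_covers_H
      by (intro exI[of _ L.H] conjI exI[of _ L.G]) auto
  qed
qed

end
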